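(* Let $(M,H)$ and $(M',H')$ be Carnot manifolds of step $r$ and let $\phi:M\to M'$ be a Carnot manifold map. For every $a\in M$, the Carnot differential $\hat\phi'(a)$ is a Lie algebra map from $\mathfrak gM(a)$ to $\mathfrak gM'(\phi(a))$ and a group map from $GM(a)$ to $GM'(\phi(a))$.
   Context: All manifolds, bundles, vector fields and maps are smooth. A Carnot manifold of step $r$ is a pair $(M,H)$, where $M$ is a manifold and $H=(H_1,\ldots,H_r)$ is a filtration of vector subbundles $H_1\subset H_2\subset\cdots\subset H_r=TM$ such that $[X,Y]$ is a section of $H_{w+w'}$ whenever $X$ is a section of $H_w$, $Y$ is a section of $H_{w'}$ and $w+w'\le r$. A Carnot manifold map between step $r$ Carnot manifolds $(M,H)$ and $(M',H')$ is a smooth map $\phi:M\to M'$ such that $\phi'(x)(H_j(x))\subset H'_j(\phi(x))$ for all $x\in M$ and $j=1,\ldots,r$, where $\phi'(x)$ is the usual differential. Set $H_0=\{0\}$, $\mathfrak g_wM=H_w/H_{w-1}$ and $\mathfrak gM=\mathfrak g_1M\oplus\cdots\oplus\mathfrak g_rM$. Each fiber $\mathfrak gM(a)$ is a graded nilpotent Lie algebra for the following (well-defined) bracket: if $\xi\in\mathfrak g_wM(a)$ and $\eta\in\mathfrak g_{w'}M(a)$ are the classes of $X(a)$ and $Y(a)$, where $X$, $Y$ are sections near $a$ of $H_w$, $H_{w'}$, then $[\xi,\eta]$ is the class of $[X,Y](a)$ in $\mathfrak g_{w+w'}M(a)$ if $w+w'\le r$, and $[\xi,\eta]=0$ if $w+w'>r$;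 this is extended bilinearly. The tangent group $GM(a)$ is the set $\mathfrak gM(a)$ equipped with the Dynkin (Baker-Campbell-Hausdorff) product $\xi\cdot\eta=\xi+\eta+\frac12[\xi,\eta]+\frac1{12}([\xi,[\xi,\eta]]+[\eta,[\eta,\xi]])+\cdots$ (a finite sum). Carnot differential: for $a\in M$, $\phi'(a)$ maps $H_w(a)$ into $H'_w(\phi(a))$ for every $w$, hence induces linear maps $\hat\phi'_{[w]}(a):\mathfrak g_wM(a)\to\mathfrak g_wM'(\phi(a))$. The Carnot differential of $\phi$ at $a$ is $\hat\phi'(a)=\hat\phi'_{[1]}(a)\oplus\cdots\oplus\hat\phi'_{[r]}(a):\mathfrak gM(a)\to\mathfrak gM'(\phi(a))$, also viewed as a map $GM(a)\to GM'(\phi(a))$. *)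

theory Defs
  imports
    "HOL-Analysis.Analysis"
    "HOL-Library.Function_Algebras"
    "HOL-Algebra.Group"
    "HOL-Algebra.FiniteProduct"
begin

instantiation "fun" :: (type, scaleR) scaleR
begin

definition scaleR_fun_def: "c *\<^sub>R f = (\<lambda>x. c *\<^sub>R f x)"

instance ..

end

instance "fun" :: (type, real_vector) real_vector
  by standard
    (simp_all add: scaleR_fun_def fun_eq_iff scaleR_add_right scaleR_add_left)

text \<open>
  The iterated derivatives are taken one direction at a time.  On an open subset of a
  finite-dimensional space this gives the usual notion of a map of class C-infinity.
\<close>

primrec Ck_on :: "nat \<Rightarrow> ('e::real_normed_vector \<Rightarrow> 'f::real_normed_vector) \<Rightarrow> 'e set \<Rightarrow> bool" where
  "Ck_on 0 f S \<longleftrightarrow> continuous_on S f"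
| "Ck_on (Suc k) f S \<longleftrightarrow>
     (\<forall>x\<in>S. f differentiable (at x)) \<and> (\<forall>v. Ck_on k (\<lambda>x. frechet_derivative f (at x) v) S)"

definition smooth_on :: "'e set \<Rightarrow> ('e::real_normed_vector \<Rightarrow> 'f::real_normed_vector) \<Rightarrow> bool" where
  "smooth_on S f \<longleftrightarrow> (\<forall>k. Ck_on k f S)"

text \<open>
  A chart is a pair of an open domain and a coordinate map.  The model space is an arbitrary
  finite-dimensional inner product space; class \<^class>\<open>euclidean_space\<close> would exclude
  manifolds of dimension 0.
\<close>

record ('a, 'e) mfd =
  mtop :: "'a topology"
  atlas :: "('a set \<times> ('a \<Rightarrow> 'e)) set"

definition smooth_manifold :: "('a, 'e::real_inner) mfd \<Rightarrow> bool" where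
  "smooth_manifold M \<longleftrightarrow>
     (\<exists>B::'e set. finite B \<and> span B = UNIV) \<and>
     Hausdorff_space (mtop M) \<and> second_countable (mtop M) \<and>
     (\<Union>(U, c)\<in>atlas M. U) = topspace (mtop M) \<and>
     (\<forall>(U, c)\<in>atlas M. openin (mtop M) U \<and> open (c ` U) \<and>
        homeomorphic_map (subtopology (mtop M) U) (top_of_set (c ` U)) c) \<and>
     (\<forall>(U, c)\<in>atlas M. \<forall>(V, d)\<in>atlas M. smooth_on (c ` (U \<inter> V)) (d \<circ> inv_into U c))"

definition smooth_fun :: "('a, 'e::real_inner) mfd \<Rightarrow> 'a set \<Rightarrow> ('a \<Rightarrow> real) \<Rightarrow> bool" where
  "smooth_fun M W f \<longleftrightarrow> (\<forall>(U, c)\<in>atlas M. smooth_on (c ` (U \<inter> W)) (f \<circ> inv_into U c))"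

definition smooth_near :: "('a, 'e::real_inner) mfd \<Rightarrow> 'a \<Rightarrow> ('a \<Rightarrow> real) \<Rightarrow> bool" where
  "smooth_near M a f \<longleftrightarrow> (\<exists>W. openin (mtop M) W \<and> a \<in> W \<and> smooth_fun M W f)"

definition smooth_map ::
  "('a, 'e::real_inner) mfd \<Rightarrow> ('b, 'f::real_inner) mfd \<Rightarrow> ('a \<Rightarrow> 'b) \<Rightarrow> bool" where
  "smooth_map M M' \<phi> \<longleftrightarrow>
     continuous_map (mtop M) (mtop M') \<phi> \<and>
     (\<forall>(U, c)\<in>atlas M. \<forall>(V, d)\<in>atlas M'.
        smooth_on (c ` (U \<inter> \<phi> -` V)) (d \<circ> \<phi> \<circ> inv_into U c))"

text \<open>
  Tangent vectors at \<open>a\<close> are the derivations of the algebra of germs at \<open>a\<close> of smooth functions.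
  A germ is represented by any total function which is smooth near \<open>a\<close>; on functions which are
  not smooth near \<open>a\<close> a tangent vector is 0 by convention, so that a derivation is represented
  by exactly one functional.
\<close>

type_synonym 'a tvec = "('a \<Rightarrow> real) \<Rightarrow> real"

definition tangent_space :: "('a, 'e::real_inner) mfd \<Rightarrow> 'a \<Rightarrow> 'a tvec set" where
  "tangent_space M a = {D.
     (\<forall>f. \<not> smooth_near M a f \<longrightarrow> D f = 0) \<and>
     (\<forall>f g. smooth_near M a f \<longrightarrow> smooth_near M a g \<longrightarrow>
        (\<exists>W. openin (mtop M) W \<and> a \<in> W \<and> (\<forall>x\<in>W. f x = g x)) \<longrightarrow> D f = D g) \<and>
     (\<forall>f g. smooth_near M a f \<longrightarrow> smooth_near M a g \<longrightarrow>
        D (\<lambda>x. f x + g x) = D f + D g) \<and>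
     (\<forall>c f. smooth_near M a f \<longrightarrow> D (\<lambda>x. c * f x) = c * D f) \<and>
     (\<forall>f g. smooth_near M a f \<longrightarrow> smooth_near M a g \<longrightarrow>
        D (\<lambda>x. f x * g x) = D f * g a + f a * D g)}"

definition differential ::
  "('b, 'f::real_inner) mfd \<Rightarrow> ('a \<Rightarrow> 'b) \<Rightarrow> 'a \<Rightarrow> 'a tvec \<Rightarrow> 'b tvec" where
  "differential M' \<phi> a D = (\<lambda>f. if smooth_near M' (\<phi> a) f then D (f \<circ> \<phi>) else 0)"

definition vector_field :: "('a, 'e::real_inner) mfd \<Rightarrow> 'a set \<Rightarrow> ('a \<Rightarrow> 'a tvec) \<Rightarrow> bool" where
  "vector_field M U X \<longleftrightarrow>
     (\<forall>x\<in>U. X x \<in> tangent_space M x) \<and>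
     (\<forall>V f. openin (mtop M) V \<longrightarrow> V \<subseteq> U \<longrightarrow> smooth_fun M V f \<longrightarrow> smooth_fun M V (\<lambda>x. X x f))"

definition vf_bracket ::
  "('a, 'e::real_inner) mfd \<Rightarrow> ('a \<Rightarrow> 'a tvec) \<Rightarrow> ('a \<Rightarrow> 'a tvec) \<Rightarrow> 'a \<Rightarrow> 'a tvec" where
  "vf_bracket M X Y a =
     (\<lambda>f. if smooth_near M a f then X a (\<lambda>x. Y x f) - Y a (\<lambda>x. X x f) else 0)"

definition subbundle :: "('a, 'e::real_inner) mfd \<Rightarrow> ('a \<Rightarrow> 'a tvec set) \<Rightarrow> bool" where
  "subbundle M E \<longleftrightarrow>
     (\<forall>a\<in>topspace (mtop M). \<exists>U k (e :: nat \<Rightarrow> 'a \<Rightarrow> 'a tvec).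
        openin (mtop M) U \<and> a \<in> U \<and> (\<forall>i<k. vector_field M U (e i)) \<and>
        (\<forall>x\<in>U. inj_on (\<lambda>i. e i x) {..<k} \<and> independent ((\<lambda>i. e i x) ` {..<k}) \<and>
           span ((\<lambda>i. e i x) ` {..<k}) = E x))"

definition bundle_section ::
  "('a, 'e::real_inner) mfd \<Rightarrow> ('a \<Rightarrow> 'a tvec set) \<Rightarrow> 'a set \<Rightarrow> ('a \<Rightarrow> 'a tvec) \<Rightarrow> bool" where
  "bundle_section M E U X \<longleftrightarrow> vector_field M U X \<and> (\<forall>x\<in>U. X x \<in> E x)"

text \<open>
  The filtration is indexed by \<open>1, \<dots>, r\<close>; the convention that \<open>H 0\<close> is the zero bundle is part
  of the definition, and \<open>H w\<close> for \<open>w > r\<close> is irrelevant.  The sections in the bracket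
  condition are over arbitrary open sets; by cutting off with bump functions this is the same as
  the condition for global sections.
\<close>

definition carnot_manifold ::
  "nat \<Rightarrow> ('a, 'e::real_inner) mfd \<Rightarrow> (nat \<Rightarrow> 'a \<Rightarrow> 'a tvec set) \<Rightarrow> bool" where
  "carnot_manifold r M H \<longleftrightarrow>
     smooth_manifold M \<and> 1 \<le> r \<and>
     (\<forall>a\<in>topspace (mtop M). H 0 a = {0}) \<and>
     (\<forall>w\<in>{1..r}. subbundle M (H w)) \<and>
     (\<forall>w\<in>{1..<r}. \<forall>a\<in>topspace (mtop M). H w a \<subseteq> H (Suc w) a) \<and>
     (\<forall>a\<in>topspace (mtop M). H r a = tangent_space M a) \<and>
     (\<forall>w\<ge>1. \<forall>w'\<ge>1. w + w' \<le> r \<longrightarrow>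
        (\<forall>U X Y. openin (mtop M) U \<longrightarrow> bundle_section M (H w) U X \<longrightarrow> bundle_section M (H w') U Y \<longrightarrow>
           bundle_section M (H (w + w')) U (vf_bracket M X Y)))"

definition carnot_map ::
  "nat \<Rightarrow> ('a, 'e::real_inner) mfd \<Rightarrow> (nat \<Rightarrow> 'a \<Rightarrow> 'a tvec set) \<Rightarrow>
   ('b, 'f::real_inner) mfd \<Rightarrow> (nat \<Rightarrow> 'b \<Rightarrow> 'b tvec set) \<Rightarrow> ('a \<Rightarrow> 'b) \<Rightarrow> bool" where
  "carnot_map r M H M' H' \<phi> \<longleftrightarrow>
     smooth_map M M' \<phi> \<and>
     (\<forall>x\<in>topspace (mtop M). \<forall>j\<in>{1..r}. differential M' \<phi> x ` H j x \<subseteq> H' j (\<phi> x))"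

record 'v lie_alg = "'v partial_object" +
  ladd :: "'v \<Rightarrow> 'v \<Rightarrow> 'v"
  lzero :: 'v
  lscale :: "real \<Rightarrow> 'v \<Rightarrow> 'v"
  lbr :: "'v \<Rightarrow> 'v \<Rightarrow> 'v"

definition lie_alg_hom :: "'v lie_alg \<Rightarrow> 'u lie_alg \<Rightarrow> ('v \<Rightarrow> 'u) set" where
  "lie_alg_hom L L' = {h. h \<in> carrier L \<rightarrow> carrier L' \<and>
     (\<forall>x\<in>carrier L. \<forall>y\<in>carrier L. h (ladd L x y) = ladd L' (h x) (h y)) \<and>
     (\<forall>c. \<forall>x\<in>carrier L. h (lscale L c x) = lscale L' c (h x)) \<and>
     (\<forall>x\<in>carrier L. \<forall>y\<in>carrier L. h (lbr L x y) = lbr L' (h x) (h y))}"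

definition lsum :: "'v lie_alg \<Rightarrow> ('i \<Rightarrow> 'v) \<Rightarrow> 'i set \<Rightarrow> 'v" where
  "lsum L f I = finprod \<lparr>carrier = carrier L, monoid.mult = ladd L, one = lzero L\<rparr> f I"

fun nested_bracket :: "'v lie_alg \<Rightarrow> 'v list \<Rightarrow> 'v" where
  "nested_bracket L [] = lzero L"
| "nested_bracket L [x] = x"
| "nested_bracket L (x # y # ys) = lbr L x (nested_bracket L (y # ys))"

text \<open>
  Dynkin's explicit form of the Baker-Campbell-Hausdorff series: the sum, over all nonempty
  lists of pairs \<open>[(p1, q1), \<dots>, (pk, qk)]\<close> with \<open>pi + qi > 0\<close>, of the right-nested
  bracket of the word \<open>x^p1 y^q1 \<dots> x^pk y^qk\<close> with coefficient
  \<open>(-1)^(k-1) / (k * n * (\<Prod>i. pi! * qi!))\<close>, where \<open>n = (\<Sum>i. pi + qi)\<close> is its length.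
  In a Lie algebra of nilpotency step at most \<open>r\<close> all brackets of \<open>n > r\<close> elements vanish, so
  the finite sum over \<open>n \<le> r\<close> is the full series.
\<close>

definition dynkin_index :: "nat \<Rightarrow> (nat \<times> nat) list set" where
  "dynkin_index r = {pq. pq \<noteq> [] \<and> (\<forall>(p, q)\<in>set pq. p + q > 0) \<and> (\<Sum>(p, q)\<leftarrow>pq. p + q) \<le> r}"

definition dynkin_coeff :: "(nat \<times> nat) list \<Rightarrow> real" where
  "dynkin_coeff pq = (- 1) ^ (length pq - 1) /
     (real (length pq) * real (\<Sum>(p, q)\<leftarrow>pq. p + q) * (\<Prod>(p, q)\<leftarrow>pq. fact p * fact q))"

definition dynkin_word :: "'v \<Rightarrow> 'v \<Rightarrow> (nat \<times> nat) list \<Rightarrow> 'v list" where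
  "dynkin_word x y pq = concat (map (\<lambda>(p, q). replicate p x @ replicate q y) pq)"

definition dynkin_product :: "nat \<Rightarrow> 'v lie_alg \<Rightarrow> 'v \<Rightarrow> 'v \<Rightarrow> 'v" where
  "dynkin_product r L x y =
     lsum L (\<lambda>pq. lscale L (dynkin_coeff pq) (nested_bracket L (dynkin_word x y pq))) (dynkin_index r)"

definition dynkin_group :: "nat \<Rightarrow> 'v lie_alg \<Rightarrow> 'v monoid" where
  "dynkin_group r L = \<lparr>carrier = carrier L, monoid.mult = dynkin_product r L, one = lzero L\<rparr>"

text \<open>
  For \<open>w \<ge> 1\<close>, an element of \<open>H w a / H (w - 1) a\<close> is a coset, as a set of tangent vectors.
\<close>

definition gr_class :: "(nat \<Rightarrow> 'a \<Rightarrow> 'a tvec set) \<Rightarrow> nat \<Rightarrow> 'a \<Rightarrow> 'a tvec \<Rightarrow> 'a tvec set" where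
  "gr_class H w a u = {v \<in> H w a. v - u \<in> H (w - 1) a}"

definition gr :: "(nat \<Rightarrow> 'a \<Rightarrow> 'a tvec set) \<Rightarrow> nat \<Rightarrow> 'a \<Rightarrow> 'a tvec set set" where
  "gr H w a = gr_class H w a ` H w a"

definition gr_add ::
  "(nat \<Rightarrow> 'a \<Rightarrow> 'a tvec set) \<Rightarrow> nat \<Rightarrow> 'a \<Rightarrow> 'a tvec set \<Rightarrow> 'a tvec set \<Rightarrow> 'a tvec set" where
  "gr_add H w a A B = (\<Union>u\<in>A. \<Union>v\<in>B. gr_class H w a (u + v))"

definition gr_scale ::
  "(nat \<Rightarrow> 'a \<Rightarrow> 'a tvec set) \<Rightarrow> nat \<Rightarrow> 'a \<Rightarrow> real \<Rightarrow> 'a tvec set \<Rightarrow> 'a tvec set" where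
  "gr_scale H w a c A = (\<Union>u\<in>A. gr_class H w a (c *\<^sub>R u))"

definition gr_sum ::
  "(nat \<Rightarrow> 'a \<Rightarrow> 'a tvec set) \<Rightarrow> nat \<Rightarrow> 'a \<Rightarrow> ('i \<Rightarrow> 'a tvec set) \<Rightarrow> 'i set \<Rightarrow> 'a tvec set" where
  "gr_sum H w a f I =
     finprod \<lparr>carrier = gr H w a, monoid.mult = gr_add H w a, one = gr_class H w a 0\<rparr> f I"

definition gr_bracket ::
  "('a, 'e::real_inner) mfd \<Rightarrow> (nat \<Rightarrow> 'a \<Rightarrow> 'a tvec set) \<Rightarrow> 'a \<Rightarrow> nat \<Rightarrow> nat \<Rightarrow>
   'a tvec set \<Rightarrow> 'a tvec set \<Rightarrow> 'a tvec set" where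
  "gr_bracket M H a w w' A B =
     (THE C. \<exists>U X Y. openin (mtop M) U \<and> a \<in> U \<and>
        bundle_section M (H w) U X \<and> bundle_section M (H w') U Y \<and>
        A = gr_class H w a (X a) \<and> B = gr_class H w' a (Y a) \<and>
        C = gr_class H (w + w') a (vf_bracket M X Y a))"

text \<open>
  The component of a bracket in degree \<open>k\<close> collects the brackets of the components in degrees
  \<open>w\<close> and \<open>w'\<close> with \<open>w + w' = k\<close>.  Only \<open>k \<le> r\<close> occurs, which encodes that brackets with
  \<open>w + w' > r\<close> are zero.
\<close>

definition osc_algebra ::
  "nat \<Rightarrow> ('a, 'e::real_inner) mfd \<Rightarrow> (nat \<Rightarrow> 'a \<Rightarrow> 'a tvec set) \<Rightarrow> 'a \<Rightarrow>
   (nat \<Rightarrow> 'a tvec set) lie_alg" where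
  "osc_algebra r M H a = \<lparr>
     carrier = (\<Pi>\<^sub>E w\<in>{1..r}. gr H w a),
     ladd = (\<lambda>\<xi> \<eta>. \<lambda>w\<in>{1..r}. gr_add H w a (\<xi> w) (\<eta> w)),
     lzero = (\<lambda>w\<in>{1..r}. gr_class H w a 0),
     lscale = (\<lambda>c \<xi>. \<lambda>w\<in>{1..r}. gr_scale H w a c (\<xi> w)),
     lbr = (\<lambda>\<xi> \<eta>. \<lambda>k\<in>{1..r}.
        gr_sum H k a (\<lambda>w. gr_bracket M H a w (k - w) (\<xi> w) (\<eta> (k - w))) {1..<k})\<rparr>"

definition tangent_group ::
  "nat \<Rightarrow> ('a, 'e::real_inner) mfd \<Rightarrow> (nat \<Rightarrow> 'a \<Rightarrow> 'a tvec set) \<Rightarrow> 'a \<Rightarrow>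
   (nat \<Rightarrow> 'a tvec set) monoid" where
  "tangent_group r M H a = dynkin_group r (osc_algebra r M H a)"

definition carnot_differential ::
  "nat \<Rightarrow> ('b, 'f::real_inner) mfd \<Rightarrow> (nat \<Rightarrow> 'b \<Rightarrow> 'b tvec set) \<Rightarrow> ('a \<Rightarrow> 'b) \<Rightarrow> 'a \<Rightarrow>
   (nat \<Rightarrow> 'a tvec set) \<Rightarrow> (nat \<Rightarrow> 'b tvec set)" where
  "carnot_differential r M' H' \<phi> a \<xi> =
     (\<lambda>w\<in>{1..r}. \<Union>u\<in>\<xi> w. gr_class H' w (\<phi> a) (differential M' \<phi> a u))"

end

theory Submission
  imports Defs
begin

text \<open>
  Let \<open>b = \<phi> a\<close> and write \<open>\<phi>'\<close> for the differential.  Suppose first that sections \<open>X\<close>, \<open>Y\<close>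
  of \<open>H w\<close>, \<open>H w'\<close> near \<open>a\<close> and \<open>P\<close>, \<open>Q\<close> of \<open>H' w\<close>, \<open>H' w'\<close> near \<open>b\<close> satisfy
  \<open>\<phi>' (X a) = P b\<close> and \<open>\<phi>' (Y a) = Q b\<close>.  Then \<open>Z x = \<phi>' (Y x) - Q (\<phi> x)\<close> is a section of
  \<open>H' w'\<close> along \<open>\<phi>\<close> that vanishes at \<open>a\<close>, so its derivative in the direction \<open>X a\<close> is an element
  of \<open>H' w' b\<close>; likewise with \<open>X\<close> and \<open>Y\<close> exchanged.  Since
  \<open>\<phi>' [X, Y] (f) - [P, Q] (f)\<close> at \<open>b\<close> is the difference of these two derivatives, it lies in
  \<open>H' (w + w' - 1) b\<close>.  If the hypotheses hold only modulo \<open>H' (w - 1) b\<close> and \<open>H' (w' - 1) b\<close>,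
  then \<open>P\<close> and \<open>Q\<close> are corrected by sections of \<open>H' (w - 1)\<close> and \<open>H' (w' - 1)\<close>, which changes
  \<open>[P, Q] b\<close> only by elements of \<open>H' (w + w' - 1) b\<close>.  The case of the identity map shows that the
  bracket on the graded pieces is well defined.
\<close>

subsection \<open>Maps of class C-k\<close>

lemma Ck_on_subset: "Ck_on k f S \<Longrightarrow> T \<subseteq> S \<Longrightarrow> Ck_on k f T"
  by (induction k arbitrary: f) (auto intro: continuous_on_subset)

lemma has_derivative_cong_open:
  assumes "open S" "x \<in> S" "\<And>y. y \<in> S \<Longrightarrow> f y = g y"
  shows "(f has_derivative D) (at x) \<longleftrightarrow> (g has_derivative D) (at x)"
  using has_derivative_transform_within_open[OF _ assms(1,2), of f D UNIV g]
    has_derivative_transform_within_open[OF _ assms(1,2), of g D UNIV f] assms(3)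
  by metis

text \<open>Openness of \<open>S\<close> matters: the derivative at a point of \<open>S\<close> sees
  a full neighbourhood, and agreement is known only inside \<open>S\<close>.\<close>

lemma Ck_on_cong:
  assumes "open S" "\<And>y. y \<in> S \<Longrightarrow> f y = g y" "Ck_on k f S"
  shows "Ck_on k g S"
  using assms(2,3)
proof (induction k arbitrary: f g)
  case 0
  then show ?case by (simp cong: continuous_on_cong)
next
  case (Suc k)
  have iff: "(f has_derivative D) (at x) \<longleftrightarrow> (g has_derivative D) (at x)" if "x \<in> S" for x D
    using assms(1) that Suc.prems(1) by (rule has_derivative_cong_open)
  have eq: "frechet_derivative f (at x) v = frechet_derivative g (at x) v" if "x \<in> S" for x v
    by (simp add: frechet_derivative_def iff[OF that])
  have "Ck_on k (\<lambda>x. frechet_derivative g (at x) v) S" for v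
    by (rule Suc.IH[of "\<lambda>x. frechet_derivative f (at x) v"]) (use eq Suc.prems(2) in auto)
  moreover have "g differentiable (at x)" if "x \<in> S" for x
    using that Suc.prems(2) iff[OF that] unfolding differentiable_def Ck_on.simps by metis
  ultimately show ?case by simp
qed

text \<open>At a successor the definition of \<open>Ck_on\<close> does not mention continuity, so
  the base case rests on differentiability implying continuity.\<close>

lemma Ck_on_SucD: "Ck_on (Suc k) f S \<Longrightarrow> Ck_on k f S"
proof (induction k arbitrary: f)
  case 0
  then show ?case
    by (auto intro!: differentiable_imp_continuous_on
        simp: differentiable_on_def differentiable_at_withinI)
next
  case (Suc k)
  have "\<forall>x\<in>S. f differentiable (at x)"
    using Suc.prems by simp
  moreover have "Ck_on k (\<lambda>x. frechet_derivative f (at x) v) S" for v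
    using Suc.prems by (intro Suc.IH) (simp only: Ck_on.simps(2)[of "Suc k" f])
  ultimately show ?case by simp
qed

text \<open>Replaces \<open>frechet_derivative\<close> by an explicit formula, so that the closure
  lemmas below only have to exhibit the sum, product or chain rule.\<close>

lemma Ck_on_SucI:
  assumes "open S"
    and "\<And>x. x \<in> S \<Longrightarrow> (f has_derivative f' x) (at x)"
    and "\<And>v. Ck_on k (\<lambda>x. f' x v) S"
  shows "Ck_on (Suc k) f S"
proof -
  have "f' x = frechet_derivative f (at x)" if "x \<in> S" for x
    using assms(2)[OF that] by (rule frechet_derivative_at)
  then have "Ck_on k (\<lambda>x. frechet_derivative f (at x) v) S" for v
    by (intro Ck_on_cong[OF assms(1) _ assms(3)]) simp
  then show ?thesis using assms(2) by (auto simp: differentiable_def)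
qed

lemma Ck_on_has_derivative:
  "Ck_on (Suc k) f S \<Longrightarrow> x \<in> S \<Longrightarrow> (f has_derivative frechet_derivative f (at x)) (at x)"
  by (simp add: frechet_derivative_works)

lemma Ck_on_const: "open S \<Longrightarrow> Ck_on k (\<lambda>x. c) S"
proof (induction k arbitrary: c)
  case (Suc k)
  then show ?case by (intro Ck_on_SucI[where f' = "\<lambda>x v. 0"]) auto
qed auto

lemma Ck_on_add:
  "open S \<Longrightarrow> Ck_on k f S \<Longrightarrow> Ck_on k g S \<Longrightarrow> Ck_on k (\<lambda>x. f x + g x) S"
proof (induction k arbitrary: f g)
  case (Suc k)
  show ?case
  proof (rule Ck_on_SucI[OF Suc.prems(1)])
    show "((\<lambda>x. f x + g x) has_derivative
        (\<lambda>v. frechet_derivative f (at x) v + frechet_derivative g (at x) v)) (at x)" if "x \<in> S" for x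
      using Suc.prems that by (intro has_derivative_add Ck_on_has_derivative)
  qed (use Suc in auto)
qed (auto intro: continuous_on_add)

lemma Ck_on_mult:
  fixes f g :: "'e::real_normed_vector \<Rightarrow> real"
  shows "open S \<Longrightarrow> Ck_on k f S \<Longrightarrow> Ck_on k g S \<Longrightarrow> Ck_on k (\<lambda>x. f x * g x) S"
proof (induction k arbitrary: f g)
  case (Suc k)
  show ?case
  proof (rule Ck_on_SucI[OF Suc.prems(1)])
    show "((\<lambda>x. f x * g x) has_derivative
        (\<lambda>v. f x * frechet_derivative g (at x) v + frechet_derivative f (at x) v * g x)) (at x)"
      if "x \<in> S" for x
      using Suc.prems that by (intro has_derivative_mult Ck_on_has_derivative)
    \<comment> \<open>The product rule also contains the undifferentiated factors, which are lowered
      from class \<open>Suc k\<close> to class \<open>k\<close>.\<close>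
    show "Ck_on k (\<lambda>x. f x * frechet_derivative g (at x) v + frechet_derivative f (at x) v * g x) S" for v
      using Suc.prems by (intro Ck_on_add Suc.IH Ck_on_SucD[of k f] Ck_on_SucD[of k g]) auto
  qed
qed (auto intro: continuous_on_mult)

lemma Ck_on_bounded_linear:
  assumes "bounded_linear L"
  shows "open S \<Longrightarrow> Ck_on k f S \<Longrightarrow> Ck_on k (\<lambda>x. L (f x)) S"
proof (induction k arbitrary: f)
  case 0
  then show ?case using bounded_linear.continuous_on[OF assms] by auto
next
  case (Suc k)
  show ?case
  proof (rule Ck_on_SucI[OF Suc.prems(1)])
    show "((\<lambda>x. L (f x)) has_derivative (\<lambda>v. L (frechet_derivative f (at x) v))) (at x)"
      if "x \<in> S" for x
      using Suc.prems that by (intro bounded_linear.has_derivative[OF assms] Ck_on_has_derivative)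
  qed (use Suc in auto)
qed

lemma Ck_on_sum:
  "open S \<Longrightarrow> (\<And>i. i \<in> I \<Longrightarrow> Ck_on k (f i) S) \<Longrightarrow> Ck_on k (\<lambda>x. \<Sum>i\<in>I. f i x) S"
  by (induction I rule: infinite_finite_induct) (auto intro: Ck_on_const Ck_on_add)

text \<open>Zero vectors in \<open>C\<close> are harmless, since they contribute a summand with factor \<open>0 / 0 = 0\<close>.\<close>

lemma pairwise_orthogonal_expansion:
  fixes x :: "'f::real_inner"
  assumes "finite C" "pairwise orthogonal C" "x \<in> span C"
  shows "x = (\<Sum>c\<in>C. (x \<bullet> c / (c \<bullet> c)) *\<^sub>R c)"
  using assms(3)
proof (induction rule: span_induct_alt)
  case base
  then show ?case by simp
next
  case (step k c y)
  have "(\<Sum>d\<in>C. (c \<bullet> d / (d \<bullet> d)) *\<^sub>R d) = (\<Sum>d\<in>C. if d = c then c else 0)"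
    using assms(2) step(1)
    by (intro sum.cong) (auto simp: pairwise_def orthogonal_def)
  also have "\<dots> = c" using assms(1) step(1) by simp
  finally have c: "(\<Sum>d\<in>C. (c \<bullet> d / (d \<bullet> d)) *\<^sub>R d) = c" .
  have "(\<Sum>d\<in>C. ((k *\<^sub>R c + y) \<bullet> d / (d \<bullet> d)) *\<^sub>R d) =
      k *\<^sub>R (\<Sum>d\<in>C. (c \<bullet> d / (d \<bullet> d)) *\<^sub>R d) + (\<Sum>d\<in>C. (y \<bullet> d / (d \<bullet> d)) *\<^sub>R d)"
    by (simp add: inner_add_left add_divide_distrib scaleR_add_left sum.distrib scaleR_sum_right)
  then show ?case using c step(2) by simp
qed

text \<open>
  Only directional derivatives \<open>Dg(y) c\<close> in fixed directions are known to be smooth in \<open>y\<close>,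
  so the direction \<open>Df(x) v\<close> in the chain rule is expanded in an orthogonal basis.
\<close>

lemma Ck_on_compose:
  fixes f :: "'e::real_normed_vector \<Rightarrow> 'f::real_inner" and g :: "'f \<Rightarrow> real"
  assumes "finite B" "span B = (UNIV :: 'f set)" "open S" "f ` S \<subseteq> T"
  shows "Ck_on k f S \<Longrightarrow> Ck_on k g T \<Longrightarrow> Ck_on k (\<lambda>x. g (f x)) S"
proof -
  obtain C :: "'f set" where C: "finite C" "span C = UNIV" "pairwise orthogonal C"
    using basis_orthogonal[OF assms(1)] assms(2) by auto
  show "Ck_on k f S \<Longrightarrow> Ck_on k g T \<Longrightarrow> Ck_on k (\<lambda>x. g (f x)) S"
  proof (induction k arbitrary: g)
    case 0
    then show ?case using assms(4) by (auto intro: continuous_on_compose2)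
  next
    case (Suc k)
    let ?f' = "\<lambda>x. frechet_derivative f (at x)" and ?g' = "\<lambda>y. frechet_derivative g (at y)"
    show ?case
    proof (rule Ck_on_SucI[OF assms(3)])
      fix x assume x: "x \<in> S"
      have g': "(g has_derivative ?g' (f x)) (at (f x))"
        using Suc.prems(2) x assms(4) by (intro Ck_on_has_derivative) auto
      have lin: "linear (?g' (f x))" using g' by (rule has_derivative_linear)
      have expand: "?g' (f x) w = (\<Sum>c\<in>C. (w \<bullet> c / (c \<bullet> c)) * ?g' (f x) c)" for w
      proof -
        have "w = (\<Sum>c\<in>C. (w \<bullet> c / (c \<bullet> c)) *\<^sub>R c)"
          using pairwise_orthogonal_expansion[OF C(1,3), of w] C(2) by simp
        then have "?g' (f x) w = ?g' (f x) (\<Sum>c\<in>C. (w \<bullet> c / (c \<bullet> c)) *\<^sub>R c)" by simp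
        also have "\<dots> = (\<Sum>c\<in>C. (w \<bullet> c / (c \<bullet> c)) * ?g' (f x) c)"
          using lin by (simp add: linear_sum linear_scale)
        finally show ?thesis .
      qed
      have "((\<lambda>x. g (f x)) has_derivative (\<lambda>v. ?g' (f x) (?f' x v))) (at x)"
        using has_derivative_compose[OF Ck_on_has_derivative[OF Suc.prems(1) x] g'] .
      also have "(\<lambda>v. ?g' (f x) (?f' x v)) =
          (\<lambda>v. \<Sum>c\<in>C. (?f' x v \<bullet> c / (c \<bullet> c)) * ?g' (f x) c)"
        by (rule ext) (rule expand)
      finally show "((\<lambda>x. g (f x)) has_derivative
          (\<lambda>v. \<Sum>c\<in>C. (?f' x v \<bullet> c / (c \<bullet> c)) * ?g' (f x) c)) (at x)" .
    next
      fix v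
      have "Ck_on k (\<lambda>x. ?f' x v \<bullet> c / (c \<bullet> c)) S" for c
        using Suc.prems(1) assms(3)
        by (intro Ck_on_bounded_linear[of "\<lambda>w. w \<bullet> c / (c \<bullet> c)"]
            bounded_linear_compose[OF bounded_linear_divide bounded_linear_inner_left]) auto
      \<comment> \<open>Here \<open>g\<close> is replaced by its derivative in the fixed direction
        \<open>c\<close>; this is why the induction varies \<open>g\<close> while \<open>f\<close>
        stays the same.\<close>
      moreover have "Ck_on k (\<lambda>x. ?g' (f x) c) S" for c
        using Suc.prems by (intro Suc.IH Ck_on_SucD[of k f]) auto
      ultimately show "Ck_on k (\<lambda>x. \<Sum>c\<in>C. (?f' x v \<bullet> c / (c \<bullet> c)) * ?g' (f x) c) S"
        using assms(3) by (intro Ck_on_sum Ck_on_mult)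
    qed
  qed
qed

subsection \<open>Smooth germs and tangent vectors\<close>

lemma smooth_manifold_chart:
  assumes "smooth_manifold M" "(U, c) \<in> atlas M"
  shows "openin (mtop M) U" and "inj_on c U"
    and "openin (mtop M) W \<Longrightarrow> open (c ` (U \<inter> W))"
proof -
  show U: "openin (mtop M) U" using assms by (auto simp: smooth_manifold_def)
  have c: "homeomorphic_map (subtopology (mtop M) U) (top_of_set (c ` U)) c" "open (c ` U)"
    using assms by (auto simp: smooth_manifold_def)
  have "topspace (subtopology (mtop M) U) = U"
    using openin_subset[OF U] by auto
  then show "inj_on c U" using homeomorphic_imp_injective_map[OF c(1)] by simp
  assume "openin (mtop M) W"
  then have "openin (subtopology (mtop M) U) (U \<inter> W)"
    by (auto simp: openin_subtopology)
  then have "openin (top_of_set (c ` U)) (c ` (U \<inter> W))"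
    using homeomorphic_imp_open_map[OF c(1)] by (auto simp: open_map_def)
  \<comment> \<open>The homeomorphism gives openness only relative to the image of \<open>U\<close>,
    which is itself open in the model space.\<close>
  then show "open (c ` (U \<inter> W))" using c(2) openin_open_eq by blast
qed

lemma smooth_fun_subset: "smooth_fun M W f \<Longrightarrow> V \<subseteq> W \<Longrightarrow> smooth_fun M V f"
  unfolding smooth_fun_def smooth_on_def
proof (clarify)
  fix U c k
  assume f: "\<forall>(U, c)\<in>atlas M. \<forall>k. Ck_on k (f \<circ> inv_into U c) (c ` (U \<inter> W))"
    and VW: "V \<subseteq> W" and c: "(U, c) \<in> atlas M"
  have "Ck_on k (f \<circ> inv_into U c) (c ` (U \<inter> W))" using f c by blast
  then show "Ck_on k (f \<circ> inv_into U c) (c ` (U \<inter> V))"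
    by (rule Ck_on_subset) (use VW in blast)
qed

context
  fixes M :: "('a, 'e::real_inner) mfd" and W
  assumes M: "smooth_manifold M" and W: "openin (mtop M) W"
begin

lemma smooth_fun_cong:
  assumes "smooth_fun M W f" "\<And>x. x \<in> W \<Longrightarrow> f x = g x"
  shows "smooth_fun M W g"
  unfolding smooth_fun_def smooth_on_def
proof (clarify)
  fix U c k assume c: "(U, c) \<in> atlas M"
  have "(f \<circ> inv_into U c) y = (g \<circ> inv_into U c) y" if "y \<in> c ` (U \<inter> W)" for y
    using that assms(2) smooth_manifold_chart(2)[OF M c] by auto
  then show "Ck_on k (g \<circ> inv_into U c) (c ` (U \<inter> W))"
    by (rule Ck_on_cong[OF smooth_manifold_chart(3)[OF M c W]])
      (use assms(1) c in \<open>auto simp: smooth_fun_def smooth_on_def comp_def\<close>)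
qed

lemma smooth_fun_const: "smooth_fun M W (\<lambda>x. C)"
  unfolding smooth_fun_def smooth_on_def comp_def
  using smooth_manifold_chart(3)[OF M _ W] by (auto intro: Ck_on_const)

lemma smooth_fun_add:
  assumes "smooth_fun M W f" "smooth_fun M W g"
  shows "smooth_fun M W (\<lambda>x. f x + g x)"
  unfolding smooth_fun_def smooth_on_def comp_def
proof (clarify)
  fix U c k assume c: "(U, c) \<in> atlas M"
  show "Ck_on k (\<lambda>x. f (inv_into U c x) + g (inv_into U c x)) (c ` (U \<inter> W))"
    using assms c by (intro Ck_on_add smooth_manifold_chart(3)[OF M c W])
      (auto simp: smooth_fun_def smooth_on_def comp_def)
qed

lemma smooth_fun_mult:
  assumes "smooth_fun M W f" "smooth_fun M W g"
  shows "smooth_fun M W (\<lambda>x. f x * g x)"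
  unfolding smooth_fun_def smooth_on_def comp_def
proof (clarify)
  fix U c k assume c: "(U, c) \<in> atlas M"
  show "Ck_on k (\<lambda>x. f (inv_into U c x) * g (inv_into U c x)) (c ` (U \<inter> W))"
    using assms c by (intro Ck_on_mult smooth_manifold_chart(3)[OF M c W])
      (auto simp: smooth_fun_def smooth_on_def comp_def)
qed

lemma smooth_fun_sum:
  "(\<And>i. i \<in> I \<Longrightarrow> smooth_fun M W (f i)) \<Longrightarrow> smooth_fun M W (\<lambda>x. \<Sum>i\<in>I. f i x)"
  by (induction I rule: infinite_finite_induct) (auto intro: smooth_fun_const smooth_fun_add)

end

lemma smooth_near_topspace: "smooth_near M a f \<Longrightarrow> a \<in> topspace (mtop M)"
  unfolding smooth_near_def using openin_subset by fast

text \<open>The open set that witnesses smoothness at \<open>a\<close> serves each of its points.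
  Later this keeps \<open>differential\<close> away from its default value at points near the base
  point.\<close>

lemma smooth_near_eventually:
  "smooth_near M a f \<Longrightarrow> eventually (\<lambda>x. smooth_near M x f) (nhdsin (mtop M) a)"
  unfolding smooth_near_def eventually_nhdsin by blast

lemma smooth_near_cong:
  assumes M: "smooth_manifold M" and f: "smooth_near M a f"
    and eq: "eventually (\<lambda>x. f x = g x) (nhdsin (mtop M) a)"
  shows "smooth_near M a g"
proof -
  obtain W where W: "openin (mtop M) W" "a \<in> W" "smooth_fun M W f"
    using f by (auto simp: smooth_near_def)
  \<comment> \<open>Outside the space every property holds eventually along \<open>nhdsin\<close>,
    so an actual neighbourhood is available only because smoothness of \<open>f\<close> puts
    \<open>a\<close> in the space.\<close>
  obtain V where V: "openin (mtop M) V" "a \<in> V" "\<forall>x\<in>V. f x = g x"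
    using eq smooth_near_topspace[OF f] by (auto simp: eventually_nhdsin)
  have "smooth_fun M (W \<inter> V) g"
    by (rule smooth_fun_cong[OF M, of _ f]) (use V W in \<open>auto intro: smooth_fun_subset\<close>)
  then show ?thesis using V W unfolding smooth_near_def by blast
qed

lemma smooth_near_const:
  "smooth_manifold M \<Longrightarrow> a \<in> topspace (mtop M) \<Longrightarrow> smooth_near M a (\<lambda>x. C)"
  using smooth_fun_const[of M "topspace (mtop M)"] by (auto simp: smooth_near_def)

lemma
  assumes M: "smooth_manifold M" and f: "smooth_near M a f" and g: "smooth_near M a g"
  shows smooth_near_add: "smooth_near M a (\<lambda>x. f x + g x)"
    and smooth_near_mult: "smooth_near M a (\<lambda>x. f x * g x)"
proof -
  obtain V W where V: "openin (mtop M) V" "a \<in> V" "smooth_fun M V f"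
    and W: "openin (mtop M) W" "a \<in> W" "smooth_fun M W g"
    using f g by (auto simp: smooth_near_def)
  have VW: "openin (mtop M) (V \<inter> W)" "a \<in> V \<inter> W" "smooth_fun M (V \<inter> W) f" "smooth_fun M (V \<inter> W) g"
    using V W by (auto intro: smooth_fun_subset)
  show "smooth_near M a (\<lambda>x. f x + g x)" "smooth_near M a (\<lambda>x. f x * g x)"
    unfolding smooth_near_def
    using VW smooth_fun_add[OF M VW(1,3,4)] smooth_fun_mult[OF M VW(1,3,4)] by blast+
qed

lemma smooth_near_cmult:
  "smooth_manifold M \<Longrightarrow> smooth_near M a f \<Longrightarrow> smooth_near M a (\<lambda>x. C * f x)"
  by (intro smooth_near_mult smooth_near_const smooth_near_topspace)

lemma smooth_near_diff:
  assumes "smooth_manifold M" "smooth_near M a f" "smooth_near M a g"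
  shows "smooth_near M a (\<lambda>x. f x - g x)"
  using smooth_near_add[OF assms(1,2) smooth_near_cmult[OF assms(1,3), of "- 1"]] by simp

lemma smooth_near_sum:
  assumes "smooth_manifold M" "a \<in> topspace (mtop M)" "\<And>i. i \<in> I \<Longrightarrow> smooth_near M a (f i)"
  shows "smooth_near M a (\<lambda>x. \<Sum>i\<in>I. f i x)"
  using assms(3)
  by (induction I rule: infinite_finite_induct)
    (auto intro: assms smooth_near_const smooth_near_add)

lemma smooth_map_eventually:
  assumes "smooth_map M M' \<phi>" "a \<in> topspace (mtop M)" "eventually P (nhdsin (mtop M') (\<phi> a))"
  shows "eventually (\<lambda>x. P (\<phi> x)) (nhdsin (mtop M) a)"
proof -
  have cont: "continuous_map (mtop M) (mtop M') \<phi>" using assms(1) by (simp add: smooth_map_def)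
  then have "\<phi> a \<in> topspace (mtop M')" using assms(2) by (auto simp: continuous_map_def)
  then obtain W where W: "openin (mtop M') W" "\<phi> a \<in> W" "\<forall>y\<in>W. P y"
    using assms(3) by (auto simp: eventually_nhdsin)
  have "openin (mtop M) {x \<in> topspace (mtop M). \<phi> x \<in> W}"
    using cont W(1) by (simp add: continuous_map_def)
  then show ?thesis unfolding eventually_nhdsin using W assms(2) by blast
qed

text \<open>In charts \<open>c\<close> and \<open>d\<close> the composite is
  \<open>h \<circ> inv_into V d\<close> after the coordinate expression of \<phi>.
  \<open>Ck_on_compose\<close> applies once the domain is shrunk so that \<phi> stays inside the
  chart \<open>d\<close> and the set where \<open>h\<close> is smooth.\<close>

lemma smooth_near_compose:
  assumes M: "smooth_manifold M" and M': "smooth_manifold M'" and \<phi>: "smooth_map M M' \<phi>"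
    and a: "a \<in> topspace (mtop M)" and h: "smooth_near M' (\<phi> a) h"
  shows "smooth_near M a (\<lambda>x. h (\<phi> x))"
proof -
  have cont: "continuous_map (mtop M) (mtop M') \<phi>" using \<phi> by (simp add: smooth_map_def)
  obtain W where W: "openin (mtop M') W" "\<phi> a \<in> W" "smooth_fun M' W h"
    using h by (auto simp: smooth_near_def)
  have "\<phi> a \<in> (\<Union>(V, d)\<in>atlas M'. V)"
    using M' smooth_near_topspace[OF h] by (simp add: smooth_manifold_def)
  \<comment> \<open>One chart around \<open>\<phi> a\<close> is enough, whereas \<open>c\<close>
    below ranges over the whole atlas of \<open>M\<close>, as \<open>smooth_fun\<close>
    demands.\<close>
  then obtain V d where d: "(V, d) \<in> atlas M'" "\<phi> a \<in> V" by auto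
  define N where "N = {x \<in> topspace (mtop M). \<phi> x \<in> V \<inter> W}"
  have N: "openin (mtop M) N"
    using cont openin_Int[OF smooth_manifold_chart(1)[OF M' d(1)] W(1)]
    unfolding N_def continuous_map_def by blast
  obtain B where B: "finite B" "span B = (UNIV :: 'd set)"
    using M' by (auto simp: smooth_manifold_def)
  have "Ck_on k (\<lambda>y. h (\<phi> (inv_into U c y))) (c ` (U \<inter> N))" if c: "(U, c) \<in> atlas M" for U c k
  proof -
    have inv: "inv_into U c y \<in> N" if "y \<in> c ` (U \<inter> N)" for y
      using that smooth_manifold_chart(2)[OF M c] by auto
    have "Ck_on k (\<lambda>y. (h \<circ> inv_into V d) ((d \<circ> \<phi> \<circ> inv_into U c) y)) (c ` (U \<inter> N))"
    proof (rule Ck_on_compose[OF B smooth_manifold_chart(3)[OF M c N]])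
      show "(d \<circ> \<phi> \<circ> inv_into U c) ` c ` (U \<inter> N) \<subseteq> d ` (V \<inter> W)"
        using inv by (auto simp: N_def)
      have "c ` (U \<inter> N) \<subseteq> c ` (U \<inter> \<phi> -` V)" by (auto simp: N_def)
      then show "Ck_on k (d \<circ> \<phi> \<circ> inv_into U c) (c ` (U \<inter> N))"
        using \<phi> c d(1) unfolding smooth_map_def smooth_on_def by (blast intro: Ck_on_subset)
      show "Ck_on k (h \<circ> inv_into V d) (d ` (V \<inter> W))"
        using W(3) d(1) by (auto simp: smooth_fun_def smooth_on_def)
    qed
    then show ?thesis
    proof (rule Ck_on_cong[OF smooth_manifold_chart(3)[OF M c N], rotated])
      fix y assume "y \<in> c ` (U \<inter> N)"
      then show "(h \<circ> inv_into V d) ((d \<circ> \<phi> \<circ> inv_into U c) y) = h (\<phi> (inv_into U c y))"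
        using inv smooth_manifold_chart(2)[OF M' d(1)] by (auto simp: N_def)
    qed
  qed
  then have "smooth_fun M N (\<lambda>x. h (\<phi> x))"
    by (auto simp: smooth_fun_def smooth_on_def comp_def)
  moreover have "a \<in> N" using a d(2) W(2) by (simp add: N_def)
  ultimately show ?thesis using N unfolding smooth_near_def by blast
qed

section \<open>Tangent vectors as derivations of germs\<close>

context
  fixes M :: "('a, 'e::real_inner) mfd" and a D
  assumes D: "D \<in> tangent_space M a"
begin

lemma tangent_not_smooth: "\<not> smooth_near M a f \<Longrightarrow> D f = 0"
  using D unfolding tangent_space_def mem_Collect_eq by blast

lemma tangent_germ:
  assumes "smooth_near M a f" "smooth_near M a g"
    and "openin (mtop M) W" "a \<in> W" "\<And>x. x \<in> W \<Longrightarrow> f x = g x"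
  shows "D f = D g"
  using D assms unfolding tangent_space_def mem_Collect_eq by blast

lemma tangent_add:
  "smooth_near M a f \<Longrightarrow> smooth_near M a g \<Longrightarrow> D (\<lambda>x. f x + g x) = D f + D g"
  using D unfolding tangent_space_def mem_Collect_eq by blast

lemma tangent_cmult: "smooth_near M a f \<Longrightarrow> D (\<lambda>x. C * f x) = C * D f"
  using D unfolding tangent_space_def mem_Collect_eq by blast

lemma tangent_mult:
  "smooth_near M a f \<Longrightarrow> smooth_near M a g \<Longrightarrow> D (\<lambda>x. f x * g x) = D f * g a + f a * D g"
  using D unfolding tangent_space_def mem_Collect_eq by blast

lemma tangent_zero: "D (\<lambda>x. 0) = 0"
proof (cases "smooth_near M a (\<lambda>x. 0)")
  case True
  then show ?thesis using tangent_cmult[OF True, of 0] by simp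
qed (rule tangent_not_smooth)

text \<open>Functions that agree near \<open>a\<close> are both smooth there or both not; in the
  second case both values are 0 by convention. So a germ can be rewritten without a smoothness
  proof.\<close>

lemma tangent_cong:
  assumes "smooth_manifold M" and eq: "eventually (\<lambda>x. f x = g x) (nhdsin (mtop M) a)"
  shows "D f = D g"
proof (cases "smooth_near M a f")
  case True
  have "\<exists>W. openin (mtop M) W \<and> a \<in> W \<and> (\<forall>x\<in>W. f x = g x)"
    using eq smooth_near_topspace[OF True] by (auto simp: eventually_nhdsin)
  then show ?thesis
    using D True smooth_near_cong[OF assms(1) True eq]
    unfolding tangent_space_def mem_Collect_eq by blast
next
  case False
  have "eventually (\<lambda>x. g x = f x) (nhdsin (mtop M) a)" using eq by (simp add: eq_commute)
  then have "\<not> smooth_near M a g" using False smooth_near_cong[OF assms(1)] by blast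
  then show ?thesis using False by (simp add: tangent_not_smooth)
qed

lemma tangent_diff:
  assumes "smooth_manifold M" "smooth_near M a f" "smooth_near M a g"
  shows "D (\<lambda>x. f x - g x) = D f - D g"
  using tangent_add[OF assms(2) smooth_near_cmult[OF assms(1,3), of "- 1"]]
    tangent_cmult[OF assms(3), of "- 1"] by simp

lemma tangent_sum:
  assumes "smooth_manifold M" "finite I" "\<And>i. i \<in> I \<Longrightarrow> smooth_near M a (f i)"
    and "a \<in> topspace (mtop M)"
  shows "D (\<lambda>x. \<Sum>i\<in>I. f i x) = (\<Sum>i\<in>I. D (f i))"
  using assms(2,3)
proof (induction I rule: finite_induct)
  case empty
  then show ?case by (simp add: tangent_zero)
next
  case (insert i I)
  then show ?case
    using tangent_add[OF _ smooth_near_sum[OF assms(1,4), of I f], of "f i"] by simp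
qed

end

lemma sum_fun_apply: "(\<Sum>i\<in>I. f i) x = (\<Sum>i\<in>I. f i x)"
  by (induction I rule: infinite_finite_induct) auto

lemma tangent_spaceI:
  assumes "\<And>f. \<not> smooth_near M a f \<Longrightarrow> D f = 0"
    and "\<And>f g W. \<lbrakk>smooth_near M a f; smooth_near M a g; openin (mtop M) W; a \<in> W;
      \<And>x. x \<in> W \<Longrightarrow> f x = g x\<rbrakk> \<Longrightarrow> D f = D g"
    and "\<And>f g. \<lbrakk>smooth_near M a f; smooth_near M a g\<rbrakk> \<Longrightarrow> D (\<lambda>x. f x + g x) = D f + D g"
    and "\<And>C f. smooth_near M a f \<Longrightarrow> D (\<lambda>x. C * f x) = C * D f"
    and "\<And>f g. \<lbrakk>smooth_near M a f; smooth_near M a g\<rbrakk> \<Longrightarrow>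
      D (\<lambda>x. f x * g x) = D f * g a + f a * D g"
  shows "D \<in> tangent_space M a"
  unfolding tangent_space_def mem_Collect_eq
proof (intro conjI)
  show "\<forall>f g. smooth_near M a f \<longrightarrow> smooth_near M a g \<longrightarrow>
      (\<exists>W. openin (mtop M) W \<and> a \<in> W \<and> (\<forall>x\<in>W. f x = g x)) \<longrightarrow> D f = D g"
    using assms(2) by blast
qed (use assms(1,3,4,5) in blast)+

lemma subspace_tangent_space: "subspace (tangent_space M a)"
  unfolding subspace_def
proof (intro conjI ballI allI)
  show "0 \<in> tangent_space M a" by (simp add: tangent_space_def)
next
  fix D E assume D: "D \<in> tangent_space M a" and E: "E \<in> tangent_space M a"
  show "D + E \<in> tangent_space M a"
  proof (rule tangent_spaceI)
    fix f g W assume "smooth_near M a f" "smooth_near M a g" "openin (mtop M) W" "a \<in> W"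
      "\<And>x. x \<in> W \<Longrightarrow> f x = g x"
    then show "(D + E) f = (D + E) g"
      using tangent_germ[OF D, of f g W] tangent_germ[OF E, of f g W] by simp
  qed (simp_all add: tangent_not_smooth[OF D] tangent_not_smooth[OF E] tangent_add[OF D]
      tangent_add[OF E] tangent_cmult[OF D] tangent_cmult[OF E] tangent_mult[OF D]
      tangent_mult[OF E] algebra_simps)
next
  fix D and C :: real assume D: "D \<in> tangent_space M a"
  show "C *\<^sub>R D \<in> tangent_space M a"
  proof (rule tangent_spaceI)
    fix f g W assume "smooth_near M a f" "smooth_near M a g" "openin (mtop M) W" "a \<in> W"
      "\<And>x. x \<in> W \<Longrightarrow> f x = g x"
    then show "(C *\<^sub>R D) f = (C *\<^sub>R D) g"
      using tangent_germ[OF D, of f g W] by (simp add: scaleR_fun_def)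
  qed (simp_all add: scaleR_fun_def tangent_not_smooth[OF D] tangent_add[OF D]
      tangent_cmult[OF D] tangent_mult[OF D] algebra_simps)
qed

section \<open>Smooth vector fields\<close>

lemma vector_field_smooth_near:
  assumes "vector_field M U X" "openin (mtop M) U" "x \<in> U" "smooth_near M x f"
  shows "smooth_near M x (\<lambda>x. X x f)"
proof -
  obtain W where W: "openin (mtop M) W" "x \<in> W" "smooth_fun M W f"
    using assms(4) by (auto simp: smooth_near_def)
  then have "smooth_fun M (U \<inter> W) f" "openin (mtop M) (U \<inter> W)"
    using assms(2) by (auto intro: smooth_fun_subset)
  then have "smooth_fun M (U \<inter> W) (\<lambda>x. X x f)"
    using assms(1) by (auto simp: vector_field_def)
  then show ?thesis using W assms(2,3) unfolding smooth_near_def by blast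
qed

lemma vector_field_sum:
  assumes M: "smooth_manifold M" and X: "\<And>i. i \<in> I \<Longrightarrow> vector_field M U (X i)"
  shows "vector_field M U (\<lambda>x. \<Sum>i\<in>I. C i *\<^sub>R X i x)"
  unfolding vector_field_def
proof (intro conjI ballI allI impI)
  fix x assume "x \<in> U"
  then show "(\<Sum>i\<in>I. C i *\<^sub>R X i x) \<in> tangent_space M x"
    using X by (intro subspace_sum[OF subspace_tangent_space] subspace_scale[OF subspace_tangent_space])
      (auto simp: vector_field_def)
next
  fix V f assume V: "openin (mtop M) V" "V \<subseteq> U" "smooth_fun M V f"
  have "smooth_fun M V (\<lambda>x. \<Sum>i\<in>I. C i * X i x f)"
    using V X by (intro smooth_fun_sum[OF M] smooth_fun_mult[OF M] smooth_fun_const[OF M])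
      (auto simp: vector_field_def)
  then show "smooth_fun M V (\<lambda>x. (\<Sum>i\<in>I. C i *\<^sub>R X i x) f)"
    by (simp add: sum_fun_apply scaleR_fun_def)
qed

subsection \<open>Sections along a map\<close>

text \<open>
  Gram-Schmidt without division: smooth functions near \<open>b\<close> are never inverted, since only the
  value at \<open>b\<close> of the common denominator \<open>d\<close> has to be nonzero.
\<close>

lemma frame_coordinates:
  fixes e :: "nat \<Rightarrow> 'a \<Rightarrow> 'a tvec"
  assumes M: "smooth_manifold M" and U: "openin (mtop M) U" and b: "b \<in> U"
    and "\<forall>i<k. vector_field M U (e i)"
    and "inj_on (\<lambda>i. e i b) {..<k}" and "independent ((\<lambda>i. e i b) ` {..<k})"
  shows "\<exists>d h e'. smooth_near M b d \<and> d b \<noteq> 0 \<and> (\<forall>j<k. smooth_near M b (h j)) \<and>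
    (\<forall>j<k. \<forall>f. smooth_near M b f \<longrightarrow> smooth_near M b (\<lambda>x. e' j x f)) \<and>
    (\<forall>j<k. \<forall>x\<in>U. e' j x \<in> span ((\<lambda>i. e i x) ` {..<k})) \<and>
    (\<forall>x\<in>U. \<forall>v\<in>span ((\<lambda>i. e i x) ` {..<k}). \<forall>f. d x * v f = (\<Sum>j<k. v (h j) * e' j x f))"
  using assms(4-)
proof (induction k)
  case 0
  have "b \<in> topspace (mtop M)" using openin_subset[OF U] b by auto
  then have "smooth_near M b (\<lambda>x. 1)" by (rule smooth_near_const[OF M])
  then show ?case by (intro exI[of _ "\<lambda>x. 1"]) simp
next
  case (Suc k)
  let ?S = "\<lambda>x. (\<lambda>i. e i x) ` {..<k}"
  have top: "b \<in> topspace (mtop M)" using openin_subset[OF U] b by auto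
  have S_Suc: "(\<lambda>i. e i x) ` {..<Suc k} = insert (e k x) (?S x)" for x
    by (auto simp: lessThan_Suc)
  have "independent (?S b)"
    using Suc.prems(3) by (rule independent_mono) auto
  moreover have "inj_on (\<lambda>i. e i b) {..<k}"
    using Suc.prems(2) by (rule inj_on_subset) auto
  ultimately have "\<exists>d h e'. smooth_near M b d \<and> d b \<noteq> 0 \<and> (\<forall>j<k. smooth_near M b (h j)) \<and>
    (\<forall>j<k. \<forall>f. smooth_near M b f \<longrightarrow> smooth_near M b (\<lambda>x. e' j x f)) \<and>
    (\<forall>j<k. \<forall>x\<in>U. e' j x \<in> span (?S x)) \<and>
    (\<forall>x\<in>U. \<forall>v\<in>span (?S x). \<forall>f. d x * v f = (\<Sum>j<k. v (h j) * e' j x f))"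
    using Suc.prems(1) by (intro Suc.IH) auto
  then obtain d h e' where d: "smooth_near M b d" "d b \<noteq> 0"
    and h: "\<And>j. j < k \<Longrightarrow> smooth_near M b (h j)"
    and e'_smooth: "\<And>j f. j < k \<Longrightarrow> smooth_near M b f \<Longrightarrow> smooth_near M b (\<lambda>x. e' j x f)"
    and e'_span: "\<And>j x. j < k \<Longrightarrow> x \<in> U \<Longrightarrow> e' j x \<in> span (?S x)"
    and coord: "\<And>x v f. x \<in> U \<Longrightarrow> v \<in> span (?S x) \<Longrightarrow> d x * v f = (\<Sum>j<k. v (h j) * e' j x f)"
    by blast
  have e_smooth: "smooth_near M b (\<lambda>x. e k x f)" if "smooth_near M b f" for f
    using vector_field_smooth_near[of M U "e k", OF _ U b that] Suc.prems(1) by simp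
  \<comment> \<open>This is \<open>d x\<close> times \<open>e k x\<close> minus its expansion in the
    first \<open>k\<close> coordinates. By \<open>coord\<close> the difference would vanish if
    \<open>e k x\<close> lay in \<open>span (?S x)\<close>, so \<open>u\<close> isolates the new
    direction.\<close>
  define u where "u x = d x *\<^sub>R e k x - (\<Sum>j<k. e k x (h j) *\<^sub>R e' j x)" for x
  have u: "u x f = d x * e k x f - (\<Sum>j<k. e k x (h j) * e' j x f)" for x f
    by (simp add: u_def sum_fun_apply scaleR_fun_def)
  have u_smooth: "smooth_near M b (\<lambda>x. u x f)" if "smooth_near M b f" for f
    unfolding u using that
    by (intro smooth_near_diff[OF M] smooth_near_sum[OF M top] smooth_near_mult[OF M] d
        e_smooth e'_smooth h) auto
  have sum_span: "(\<Sum>j<k. C j *\<^sub>R e' j x) \<in> span (?S x)" if "x \<in> U" for C x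
    using that by (intro span_sum span_scale e'_span) auto
  have u_span: "u x \<in> span (insert (e k x) (?S x))" if "x \<in> U" for x
    unfolding u_def
    by (intro span_diff span_scale span_base[of "e k x"]
        subsetD[OF span_mono[OF subset_insertI] sum_span[OF that]]) simp
  have "e k b \<notin> span (?S b)"
  proof -
    have "e k b \<notin> ?S b" using Suc.prems(2) unfolding inj_on_def by fastforce
    then show ?thesis using Suc.prems(3) by (simp add: S_Suc independent_insert)
  qed
  have "u b \<noteq> 0"
  proof
    assume "u b = 0"
    then have "(1 / d b) *\<^sub>R (d b *\<^sub>R e k b) = (1 / d b) *\<^sub>R (\<Sum>j<k. e k b (h j) *\<^sub>R e' j b)"
      by (simp add: u_def)
    then have "e k b = (1 / d b) *\<^sub>R (\<Sum>j<k. e k b (h j) *\<^sub>R e' j b)"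
      using d(2) by simp
    then show False
      using \<open>e k b \<notin> span (?S b)\<close> span_scale[OF sum_span[OF b]] by metis
  qed
  \<comment> \<open>A function that detects the new direction at \<open>b\<close>; it becomes the
    last coordinate function.\<close>
  then obtain g where g: "u b g \<noteq> 0" by (auto simp: fun_eq_iff)
  have "insert (e k b) (?S b) \<subseteq> tangent_space M b"
    using Suc.prems(1) b by (auto simp: vector_field_def less_Suc_eq)
  then have "u b \<in> tangent_space M b"
    by (rule subsetD[OF span_minimal[OF _ subspace_tangent_space] u_span[OF b]])
  \<comment> \<open>Tangent vectors are 0 on functions that are not smooth near \<open>b\<close>, so
    a nonzero value on \<open>g\<close> forces smoothness.\<close>
  then have g_smooth: "smooth_near M b g"
    using g tangent_not_smooth[of "u b" M b g] by blast
  \<comment> \<open>For \<open>v\<close> in the larger span, \<open>d x * v f\<close> is the sum of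
    the \<open>v (h j) * e' j x f\<close> plus \<open>c * u x f\<close> for some number
    \<open>c\<close>. Multiplying by \<open>u x g\<close> and eliminating \<open>c\<close> through
    the case \<open>f = g\<close> produces exactly these fields and the new denominator
    \<open>u x g * d x\<close>.\<close>
  define e'' where "e'' j x = (if j < k then u x g *\<^sub>R e' j x - e' j x g *\<^sub>R u x else d x *\<^sub>R u x)" for j x
  have e'': "e'' j x f = (if j < k then u x g * e' j x f - e' j x g * u x f else d x * u x f)" for j x f
    by (simp add: e''_def scaleR_fun_def)
  show ?case
  proof (intro exI[of _ "\<lambda>x. u x g * d x"] exI[of _ "h(k := g)"] exI[of _ e''] conjI allI impI ballI)
    show "smooth_near M b (\<lambda>x. u x g * d x)"
      by (intro smooth_near_mult[OF M] u_smooth d g_smooth)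
    show "u b g * d b \<noteq> 0" using g d(2) by simp
  next
    fix j assume "j < Suc k"
    then show "smooth_near M b ((h(k := g)) j)" using h g_smooth by (auto simp: less_Suc_eq)
  next
    fix j f assume "j < Suc k" "smooth_near M b f"
    then show "smooth_near M b (\<lambda>x. e'' j x f)"
      unfolding e''
      using smooth_near_diff[OF M smooth_near_mult[OF M u_smooth[OF g_smooth] e'_smooth[of j f]]
          smooth_near_mult[OF M e'_smooth[OF _ g_smooth, of j] u_smooth[of f]]]
        smooth_near_mult[OF M d(1) u_smooth[of f]]
      by (cases "j < k") simp_all
  next
    fix j x assume jx: "j < Suc k" "x \<in> U"
    have "e' j x \<in> span (insert (e k x) (?S x))" if "j < k"
      using e'_span[OF that jx(2)] span_mono[OF subset_insertI] by blast
    then show "e'' j x \<in> span ((\<lambda>i. e i x) ` {..<Suc k})"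
      unfolding S_Suc e''_def using u_span[OF jx(2)] by (auto intro: span_diff span_scale)
  next
    \<comment> \<open>The number \<open>c\<close> obtained next may depend on \<open>x\<close>
      without any regularity; it cancels in the final identity.\<close>
    fix x v f assume x: "x \<in> U" and v: "v \<in> span ((\<lambda>i. e i x) ` {..<Suc k})"
    obtain c where c: "v - c *\<^sub>R e k x \<in> span (?S x)"
      using v unfolding S_Suc span_breakdown_eq by blast
    have coord_v: "(\<Sum>j<k. v (h j) * e' j x f) = d x * v f - c * u x f" for f
    proof -
      have "(\<Sum>j<k. v (h j) * e' j x f) - c * (\<Sum>j<k. e k x (h j) * e' j x f) =
          d x * (v f - c * e k x f)"
        using coord[OF x c, of f]
        by (simp add: scaleR_fun_def sum_distrib_left algebra_simps sum_subtractf)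
      then show ?thesis by (simp add: u algebra_simps)
    qed
    have "(\<Sum>j<Suc k. v ((h(k := g)) j) * e'' j x f) =
        (\<Sum>j<k. v (h j) * (u x g * e' j x f - e' j x g * u x f)) + v g * (d x * u x f)"
      by (simp add: e'')
    also have "(\<Sum>j<k. v (h j) * (u x g * e' j x f - e' j x g * u x f)) =
        u x g * (\<Sum>j<k. v (h j) * e' j x f) - u x f * (\<Sum>j<k. v (h j) * e' j x g)"
      by (simp add: sum_distrib_left algebra_simps sum_subtractf)
    also have "\<dots> + v g * (d x * u x f) = u x g * d x * v f"
      unfolding coord_v by (simp add: algebra_simps)
    finally show "u x g * d x * v f = (\<Sum>j<Suc k. v ((h(k := g)) j) * e'' j x f)" by simp
  qed
qed

text \<open>By \<open>frame_coordinates\<close>, a denominator times \<open>Z x f\<close> is a sum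
  of products of \<open>Z x (h j)\<close> with functions pulled back along \<phi>. Differentiating
  at \<open>a\<close>, where \<open>Z\<close> vanishes, leaves only the terms in which
  \<open>Z\<close> is differentiated, and these form a combination of the vectors
  \<open>e' j (\<phi> a)\<close> of the fibre.\<close>

lemma derivative_along_in_subbundle:
  fixes M :: "('a, 'e::real_inner) mfd" and M' :: "('b, 'f::real_inner) mfd"
  assumes M: "smooth_manifold M" and M': "smooth_manifold M'" and \<phi>: "smooth_map M M' \<phi>"
    and a: "a \<in> topspace (mtop M)" and E: "subbundle M' E" and D: "D \<in> tangent_space M a"
    and Z: "\<And>f. smooth_near M' (\<phi> a) f \<Longrightarrow> smooth_near M a (\<lambda>x. Z x f)"
    and ZE: "eventually (\<lambda>x. Z x \<in> E (\<phi> x)) (nhdsin (mtop M) a)" and Za: "Z a = 0"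
  shows "(\<lambda>f. if smooth_near M' (\<phi> a) f then D (\<lambda>x. Z x f) else 0) \<in> E (\<phi> a)"
proof -
  have b: "\<phi> a \<in> topspace (mtop M')"
    using \<phi> a by (auto simp: smooth_map_def continuous_map_def)
  then obtain U k and e :: "nat \<Rightarrow> 'b \<Rightarrow> 'b tvec" where
    *: "openin (mtop M') U \<and> \<phi> a \<in> U \<and> (\<forall>i<k. vector_field M' U (e i)) \<and>
      (\<forall>x\<in>U. inj_on (\<lambda>i. e i x) {..<k} \<and> independent ((\<lambda>i. e i x) ` {..<k}) \<and>
        span ((\<lambda>i. e i x) ` {..<k}) = E x)"
    using E[unfolded subbundle_def, rule_format, OF b] by (elim exE) (rule that)
  then have U: "openin (mtop M') U" "\<phi> a \<in> U"
    and e: "\<forall>i<k. vector_field M' U (e i)"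
    and frame: "\<And>y. y \<in> U \<Longrightarrow> inj_on (\<lambda>i. e i y) {..<k}"
      "\<And>y. y \<in> U \<Longrightarrow> independent ((\<lambda>i. e i y) ` {..<k})"
      "\<And>y. y \<in> U \<Longrightarrow> span ((\<lambda>i. e i y) ` {..<k}) = E y"
    by simp_all
  obtain d h e' where *: "smooth_near M' (\<phi> a) d \<and> d (\<phi> a) \<noteq> 0 \<and>
      (\<forall>j<k. smooth_near M' (\<phi> a) (h j)) \<and>
      (\<forall>j<k. \<forall>f. smooth_near M' (\<phi> a) f \<longrightarrow> smooth_near M' (\<phi> a) (\<lambda>x. e' j x f)) \<and>
      (\<forall>j<k. \<forall>y\<in>U. e' j y \<in> span ((\<lambda>i. e i y) ` {..<k})) \<and>
      (\<forall>y\<in>U. \<forall>v\<in>span ((\<lambda>i. e i y) ` {..<k}). \<forall>f. d y * v f = (\<Sum>j<k. v (h j) * e' j y f))"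
    using frame_coordinates[OF M' U e frame(1,2)[OF U(2)]] by (elim exE) (rule that)
  then have d: "smooth_near M' (\<phi> a) d" "d (\<phi> a) \<noteq> 0"
    and h: "\<And>j. j < k \<Longrightarrow> smooth_near M' (\<phi> a) (h j)"
    and e'_smooth: "\<And>j f. j < k \<Longrightarrow> smooth_near M' (\<phi> a) f \<Longrightarrow> smooth_near M' (\<phi> a) (\<lambda>x. e' j x f)"
    and span: "\<And>j y. j < k \<Longrightarrow> y \<in> U \<Longrightarrow> e' j y \<in> span ((\<lambda>i. e i y) ` {..<k})"
      "\<And>y v f. y \<in> U \<Longrightarrow> v \<in> span ((\<lambda>i. e i y) ` {..<k}) \<Longrightarrow>
        d y * v f = (\<Sum>j<k. v (h j) * e' j y f)"
    by blast+
  have e'_span: "e' j y \<in> E y" if "j < k" "y \<in> U" for j y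
    using span(1)[OF that] frame(3)[OF that(2)] by simp
  have coord: "d y * v f = (\<Sum>j<k. v (h j) * e' j y f)" if "y \<in> U" "v \<in> E y" for y v f
    using span(2)[OF that(1)] frame(3)[OF that(1)] that(2) by simp
  have E_sub: "subspace (E (\<phi> a))" unfolding frame(3)[OF U(2), symmetric] by (rule subspace_span)
  have E_tan: "E (\<phi> a) \<subseteq> tangent_space M' (\<phi> a)"
    unfolding frame(3)[OF U(2), symmetric]
    using e U(2) by (intro span_minimal subspace_tangent_space) (auto simp: vector_field_def)
  \<comment> \<open>The coefficients on the right do not depend on \<open>f\<close>, so this is a
    single linear combination of vectors of the fibre.\<close>
  have "(if smooth_near M' (\<phi> a) f then D (\<lambda>x. Z x f) else 0) =
      (\<Sum>j<k. (D (\<lambda>x. Z x (h j)) / d (\<phi> a)) *\<^sub>R e' j (\<phi> a)) f" for f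
  proof (cases "smooth_near M' (\<phi> a) f")
    case True
    note comp = smooth_near_compose[OF M M' \<phi> a]
    have "eventually (\<lambda>x. \<phi> x \<in> U) (nhdsin (mtop M) a)"
      using U by (intro smooth_map_eventually[OF \<phi> a]) (auto simp: eventually_nhdsin)
    with ZE have eq: "eventually (\<lambda>x. d (\<phi> x) * Z x f = (\<Sum>j<k. Z x (h j) * e' j (\<phi> x) f)) (nhdsin (mtop M) a)"
      by eventually_elim (rule coord)
    \<comment> \<open>The other Leibniz term carries the factor \<open>Z a f\<close>, which is
      0.\<close>
    have "d (\<phi> a) * D (\<lambda>x. Z x f) = D (\<lambda>x. d (\<phi> x) * Z x f)"
      by (simp add: tangent_mult[OF D comp[OF d(1)] Z[OF True]] Za)
    also have "\<dots> = D (\<lambda>x. \<Sum>j<k. Z x (h j) * e' j (\<phi> x) f)"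
      by (rule tangent_cong[OF D M eq])
    also have "\<dots> = (\<Sum>j<k. D (\<lambda>x. Z x (h j) * e' j (\<phi> x) f))"
      using True by (intro tangent_sum[OF D M _ _ a] smooth_near_mult[OF M] Z h comp e'_smooth) auto
    also have "\<dots> = (\<Sum>j<k. D (\<lambda>x. Z x (h j)) * e' j (\<phi> a) f)"
    proof (rule sum.cong[OF refl])
      fix j assume "j \<in> {..<k}"
      then show "D (\<lambda>x. Z x (h j) * e' j (\<phi> x) f) = D (\<lambda>x. Z x (h j)) * e' j (\<phi> a) f"
        using tangent_mult[OF D Z[OF h[of j]] comp[OF e'_smooth[OF _ True, of j]]] by (simp add: Za)
    qed
    finally have "D (\<lambda>x. Z x f) = (\<Sum>j<k. D (\<lambda>x. Z x (h j)) * e' j (\<phi> a) f) / d (\<phi> a)"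
      using d(2) by (simp add: field_simps)
    then show ?thesis
      using True by (simp add: sum_fun_apply scaleR_fun_def sum_divide_distrib)
  next
    case False
    \<comment> \<open>The default value on the left is matched because vectors of the fibre are
      tangent vectors, hence 0 on non-smooth functions.\<close>
    have "e' j (\<phi> a) f = 0" if "j < k" for j
      using tangent_not_smooth[OF subsetD[OF E_tan e'_span[OF that U(2)]] False] .
    then show ?thesis using False by (simp add: sum_fun_apply scaleR_fun_def)
  qed
  then have "(\<lambda>f. if smooth_near M' (\<phi> a) f then D (\<lambda>x. Z x f) else 0) =
      (\<Sum>j<k. (D (\<lambda>x. Z x (h j)) / d (\<phi> a)) *\<^sub>R e' j (\<phi> a))"
    by (rule ext)
  also have "\<dots> \<in> E (\<phi> a)"
    using U(2) by (intro subspace_sum[OF E_sub] subspace_scale[OF E_sub] e'_span) auto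
  finally show ?thesis .
qed

subsection \<open>Filtrations and brackets\<close>

lemma subbundle_frame:
  assumes "subbundle M E" "b \<in> topspace (mtop M)"
  obtains U k e where "openin (mtop M) U" "b \<in> U" "\<forall>i<(k::nat). vector_field M U (e i)"
    and "\<And>y. y \<in> U \<Longrightarrow> inj_on (\<lambda>i. e i y) {..<k}"
    and "\<And>y. y \<in> U \<Longrightarrow> independent ((\<lambda>i. e i y) ` {..<k})"
    and "\<And>y. y \<in> U \<Longrightarrow> span ((\<lambda>i. e i y) ` {..<k}) = E y"
  using assms(1)[unfolded subbundle_def, rule_format, OF assms(2)]
  by (elim exE conjE) (rule that, assumption+, simp_all)

lemma subspace_subbundle:
  assumes "subbundle M E" "b \<in> topspace (mtop M)"
  shows "subspace (E b)"
  using assms by (rule subbundle_frame) (metis subspace_span)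

text \<open>Constant coefficients in a local frame suffice, since only the value at \<open>b\<close>
  is prescribed.\<close>

lemma subbundle_section_extension:
  assumes M: "smooth_manifold M" and "subbundle M E" "b \<in> topspace (mtop M)" and u: "u \<in> E b"
  obtains U X where "openin (mtop M) U" "b \<in> U" "bundle_section M E U X" "X b = u"
  using assms(2,3)
proof (rule subbundle_frame)
  fix U k e
  assume U: "openin (mtop M) U" "b \<in> U" and e: "\<forall>i<(k::nat). vector_field M U (e i)"
    and inj: "\<And>y. y \<in> U \<Longrightarrow> inj_on (\<lambda>i. e i y) {..<k}"
    and span: "\<And>y. y \<in> U \<Longrightarrow> span ((\<lambda>i. e i y) ` {..<k}) = E y"
  have "u \<in> range (\<lambda>C. \<Sum>v\<in>(\<lambda>i. e i b) ` {..<k}. C v *\<^sub>R v)"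
    using u span[OF U(2)] span_finite[of "(\<lambda>i. e i b) ` {..<k}"] by simp
  then obtain C where "u = (\<Sum>v\<in>(\<lambda>i. e i b) ` {..<k}. C v *\<^sub>R v)" by auto
  then have C: "u = (\<Sum>i<k. C (e i b) *\<^sub>R e i b)"
    by (simp add: sum.reindex[OF inj[OF U(2)]])
  have "vector_field M U (\<lambda>x. \<Sum>i<k. C (e i b) *\<^sub>R e i x)"
    using e by (intro vector_field_sum[OF M]) simp
  moreover have "(\<Sum>i<k. C (e i b) *\<^sub>R e i x) \<in> E x" if "x \<in> U" for x
    unfolding span[OF that, symmetric] by (intro span_sum span_scale span_base) auto
  ultimately have "bundle_section M E U (\<lambda>x. \<Sum>i<k. C (e i b) *\<^sub>R e i x)"
    by (simp add: bundle_section_def)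
  then show thesis using that U C by blast
qed

lemma bundle_section_subset:
  "bundle_section M E U X \<Longrightarrow> V \<subseteq> U \<Longrightarrow> bundle_section M E V X"
  unfolding bundle_section_def vector_field_def by (meson subset_iff subset_trans)

lemma vector_field_add:
  assumes "smooth_manifold M" "vector_field M U X" "vector_field M U Y"
  shows "vector_field M U (\<lambda>x. X x + Y x)"
  unfolding vector_field_def
proof (intro conjI ballI allI impI)
  fix x assume "x \<in> U"
  then show "X x + Y x \<in> tangent_space M x"
    using assms by (intro subspace_add[OF subspace_tangent_space]) (auto simp: vector_field_def)
next
  fix V f assume V: "openin (mtop M) V" "V \<subseteq> U" "smooth_fun M V f"
  then show "smooth_fun M V (\<lambda>x. (X x + Y x) f)"
    using assms smooth_fun_add[OF assms(1) V(1), of "\<lambda>x. X x f" "\<lambda>x. Y x f"]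
    by (simp add: vector_field_def)
qed

lemma vf_bracket_swap: "vf_bracket M Y X a = - vf_bracket M X Y a"
  by (rule ext) (simp add: vf_bracket_def)

section \<open>Elementary consequences of the Carnot axioms\<close>

context
  fixes r and M :: "('a, 'e::real_inner) mfd" and H
  assumes carnot: "carnot_manifold r M H"
begin

lemma carnot_smooth: "smooth_manifold M"
  using carnot by (simp add: carnot_manifold_def)

lemma carnot_zero: "x \<in> topspace (mtop M) \<Longrightarrow> H 0 x = {0}"
  using carnot by (simp add: carnot_manifold_def)

lemma carnot_subbundle: "1 \<le> w \<Longrightarrow> w \<le> r \<Longrightarrow> subbundle M (H w)"
  using carnot by (simp add: carnot_manifold_def)

lemma carnot_subspace:
  assumes "x \<in> topspace (mtop M)" "w \<le> r"
  shows "subspace (H w x)"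
proof (cases "w = 0")
  case True
  then show ?thesis using carnot_zero[OF assms(1)] by (simp add: subspace_single_0)
next
  case False
  then show ?thesis using subspace_subbundle[OF carnot_subbundle assms(1)] assms(2) by simp
qed

lemma carnot_mono:
  assumes "x \<in> topspace (mtop M)" "w \<le> w'" "w' \<le> r"
  shows "H w x \<subseteq> H w' x"
  using assms(2,3)
proof (induction w' rule: dec_induct)
  case (step n)
  have "H n x \<subseteq> H (Suc n) x"
  proof (cases "n = 0")
    \<comment> \<open>The inclusion of \<open>H 0\<close> in \<open>H 1\<close> is not among the
      filtration clauses, which start at index 1; it holds because \<open>H 0\<close> is
      zero.\<close>
    case True
    then show ?thesis
      using carnot_zero[OF assms(1)] subspace_0[OF carnot_subspace[OF assms(1), of "Suc n"]] step by simp
  next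
    case False
    then show ?thesis using carnot assms(1) step by (simp add: carnot_manifold_def)
  qed
  then show ?case using step by auto
qed simp

lemma carnot_tangent:
  assumes "x \<in> topspace (mtop M)" "w \<le> r"
  shows "H w x \<subseteq> tangent_space M x"
proof -
  have "H r x = tangent_space M x" using carnot assms(1) by (simp add: carnot_manifold_def)
  then show ?thesis using carnot_mono[OF assms order_refl] by simp
qed

lemma carnot_section_extension:
  assumes x: "x \<in> topspace (mtop M)" and w: "w \<le> r" and u: "u \<in> H w x"
  obtains U X where "openin (mtop M) U" "x \<in> U" "bundle_section M (H w) U X" "X x = u"
proof (cases "w = 0")
  case True
  have "bundle_section M (H w) (topspace (mtop M)) (\<lambda>x. 0)"
    using True smooth_fun_const[OF carnot_smooth, of _ 0]
    by (simp add: bundle_section_def vector_field_def carnot_zero subspace_0[OF subspace_tangent_space])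
  moreover have "u = 0" using True u carnot_zero[OF x] by simp
  ultimately show ?thesis using that x by blast
next
  case False
  with w have "1 \<le> w" by simp
  from subbundle_section_extension[OF carnot_smooth carnot_subbundle[OF this w] x u] that
  show ?thesis by metis
qed

text \<open>Extends the bracket axiom to \<open>w = 0\<close>, where \<open>X\<close> vanishes on a
  neighbourhood of \<open>x\<close> and the bracket at \<open>x\<close> is therefore 0. This case is
  met when a field of degree 1 is corrected by a field of degree 0.\<close>

lemma carnot_bracket:
  assumes w: "1 \<le> w'" "w + w' \<le> r" and U: "openin (mtop M) U" "x \<in> U"
    and X: "bundle_section M (H w) U X" and Y: "bundle_section M (H w') U Y"
  shows "vf_bracket M X Y x \<in> H (w + w') x"
proof (cases "w = 0")
  case True
  have x: "x \<in> topspace (mtop M)" using openin_subset[OF U(1)] U(2) by auto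
  have zero: "X y = 0" if "y \<in> U" for y
    using X carnot_zero[of y] openin_subset[OF U(1)] that True by (auto simp: bundle_section_def)
  \<comment> \<open>The term in which \<open>Y x\<close> differentiates \<open>X\<close> vanishes
    because \<open>X\<close> is 0 near \<open>x\<close> and not only at \<open>x\<close>.\<close>
  have "eventually (\<lambda>y. X y f = 0) (nhdsin (mtop M) x)" for f
    using zero U by (auto simp: eventually_nhdsin)
  moreover have Yx: "Y x \<in> tangent_space M x" using Y U(2) by (simp add: bundle_section_def vector_field_def)
  ultimately have "Y x (\<lambda>y. X y f) = 0" for f
    using tangent_cong[OF Yx carnot_smooth, of "\<lambda>y. X y f" "\<lambda>y. 0"] tangent_zero[OF Yx] by simp
  then have "vf_bracket M X Y x = 0"
    using zero[OF U(2)] by (intro ext) (simp add: vf_bracket_def)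
  then show ?thesis using subspace_0[OF carnot_subspace[OF x w(2)]] by simp
next
  case False
  then have "bundle_section M (H (w + w')) U (vf_bracket M X Y)"
    using carnot w U X Y unfolding carnot_manifold_def by simp
  then show ?thesis using U(2) by (simp add: bundle_section_def)
qed

end

section \<open>Carnot maps and brackets of vector fields\<close>

lemma carnot_map_smooth: "carnot_map r M H M' H' \<phi> \<Longrightarrow> smooth_map M M' \<phi>"
  by (simp add: carnot_map_def)

lemma carnot_map_topspace:
  "carnot_map r M H M' H' \<phi> \<Longrightarrow> x \<in> topspace (mtop M) \<Longrightarrow> \<phi> x \<in> topspace (mtop M')"
  by (auto simp: carnot_map_def smooth_map_def continuous_map_def)

lemma carnot_map_differential:
  assumes carnot: "carnot_manifold r M H" and carnot': "carnot_manifold r M' H'"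
    and map: "carnot_map r M H M' H' \<phi>"
    and x: "x \<in> topspace (mtop M)" and w: "w \<le> r" and u: "u \<in> H w x"
  shows "differential M' \<phi> x u \<in> H' w (\<phi> x)"
proof (cases "w = 0")
  case True
  then show ?thesis
    using u carnot_zero[OF carnot x] carnot_zero[OF carnot' carnot_map_topspace[OF map x]]
    by (auto simp: differential_def fun_eq_iff)
next
  case False
  then have "w \<in> {1..r}" using w by simp
  then have "differential M' \<phi> x ` H w x \<subseteq> H' w (\<phi> x)"
    using map x unfolding carnot_map_def by blast
  then show ?thesis using u by blast
qed

context
  fixes r M H M' H' \<phi> a
  assumes carnot: "carnot_manifold r (M :: ('a, 'e::real_inner) mfd) H"
    and carnot': "carnot_manifold r (M' :: ('b, 'f::real_inner) mfd) H'"
    and map: "carnot_map r M H M' H' \<phi>" and a: "a \<in> topspace (mtop M)"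
begin

text \<open>Follows from \<open>derivative_along_in_subbundle\<close> for the difference of
  \<open>Y\<close> pushed forward and \<open>Q\<close> pulled back, a section along \<phi> that
  vanishes at \<open>a\<close> by \<open>eq\<close>.\<close>

lemma derivative_difference_in_subbundle:
  assumes w: "1 \<le> w" "w \<le> r" and D: "D \<in> tangent_space M a"
    and U: "openin (mtop M) U" "a \<in> U" and Y: "bundle_section M (H w) U Y"
    and V: "openin (mtop M') V" "\<phi> a \<in> V" and Q: "bundle_section M' (H' w) V Q"
    and eq: "differential M' \<phi> a (Y a) = Q (\<phi> a)"
  shows "(\<lambda>f. if smooth_near M' (\<phi> a) f
      then D (\<lambda>x. Y x (f \<circ> \<phi>)) - D (\<lambda>x. Q (\<phi> x) f) else 0) \<in> H' w (\<phi> a)"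
proof -
  note M = carnot_smooth[OF carnot] and M' = carnot_smooth[OF carnot']
  note comp = smooth_near_compose[OF M M' carnot_map_smooth[OF map] a]
  define Z where "Z x = differential M' \<phi> x (Y x) - Q (\<phi> x)" for x
  have smooth: "smooth_near M a (\<lambda>x. Y x (f \<circ> \<phi>))" "smooth_near M a (\<lambda>x. Q (\<phi> x) f)"
    if f: "smooth_near M' (\<phi> a) f" for f
  proof -
    have "smooth_near M a (f \<circ> \<phi>)" using comp[OF f] by (simp add: comp_def)
    then show "smooth_near M a (\<lambda>x. Y x (f \<circ> \<phi>))"
      using Y U by (auto simp: bundle_section_def intro: vector_field_smooth_near)
    have "smooth_near M' (\<phi> a) (\<lambda>y. Q y f)"
      using Q V f by (auto simp: bundle_section_def intro: vector_field_smooth_near)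
    then show "smooth_near M a (\<lambda>x. Q (\<phi> x) f)" by (rule comp)
  qed
  \<comment> \<open>The formula holds only where \<open>f\<close> is smooth near
    \<open>\<phi> x\<close>, since \<open>differential\<close> takes its default value elsewhere;
    that is the case for all \<open>x\<close> near \<open>a\<close>.\<close>
  have Z: "eventually (\<lambda>x. Y x (f \<circ> \<phi>) - Q (\<phi> x) f = Z x f) (nhdsin (mtop M) a)"
    if f: "smooth_near M' (\<phi> a) f" for f
    using smooth_map_eventually[OF carnot_map_smooth[OF map] a smooth_near_eventually[OF f]]
    by eventually_elim (simp add: Z_def differential_def)
  have "(\<lambda>f. if smooth_near M' (\<phi> a) f then D (\<lambda>x. Z x f) else 0) \<in> H' w (\<phi> a)"
  proof (rule derivative_along_in_subbundle[OF M M' carnot_map_smooth[OF map] a _ D])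
    show "subbundle M' (H' w)" using carnot_subbundle[OF carnot'] w by simp
    show "smooth_near M a (\<lambda>x. Z x f)" if f: "smooth_near M' (\<phi> a) f" for f
      by (rule smooth_near_cong[OF M smooth_near_diff[OF M smooth[OF f]] Z[OF f]])
    show "Z a = 0" using eq by (simp add: Z_def)
    have "Z x \<in> H' w (\<phi> x)" if x: "x \<in> U" "\<phi> x \<in> V" for x
    proof -
      have top: "x \<in> topspace (mtop M)" using openin_subset[OF U(1)] x(1) by auto
      have "Y x \<in> H w x" "Q (\<phi> x) \<in> H' w (\<phi> x)" using x Y Q by (auto simp: bundle_section_def)
      then show ?thesis
        unfolding Z_def using carnot_map_differential[OF carnot carnot' map top w(2)]
          subspace_diff[OF carnot_subspace[OF carnot' carnot_map_topspace[OF map top] w(2)]] by blast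
    qed
    moreover have "eventually (\<lambda>x. x \<in> U) (nhdsin (mtop M) a)"
      using U by (auto simp: eventually_nhdsin)
    moreover have "eventually (\<lambda>x. \<phi> x \<in> V) (nhdsin (mtop M) a)"
      using V by (intro smooth_map_eventually[OF carnot_map_smooth[OF map] a]) (auto simp: eventually_nhdsin)
    ultimately show "eventually (\<lambda>x. Z x \<in> H' w (\<phi> x)) (nhdsin (mtop M) a)"
      by (auto elim: eventually_elim2)
  qed
  moreover have "D (\<lambda>x. Z x f) = D (\<lambda>x. Y x (f \<circ> \<phi>)) - D (\<lambda>x. Q (\<phi> x) f)"
    if f: "smooth_near M' (\<phi> a) f" for f
    using tangent_cong[OF D M Z[OF f]] tangent_diff[OF D M smooth[OF f]] by simp
  ultimately show ?thesis by (simp cong: if_cong)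
qed

lemma bracket_congruence_exact:
  assumes w: "1 \<le> w" "1 \<le> w'" "w + w' \<le> r"
    and U: "openin (mtop M) U" "a \<in> U"
    and X: "bundle_section M (H w) U X" and Y: "bundle_section M (H w') U Y"
    and V: "openin (mtop M') V" "\<phi> a \<in> V"
    and P: "bundle_section M' (H' w) V P" and Q: "bundle_section M' (H' w') V Q"
    and XP: "differential M' \<phi> a (X a) = P (\<phi> a)" and YQ: "differential M' \<phi> a (Y a) = Q (\<phi> a)"
  shows "differential M' \<phi> a (vf_bracket M X Y a) - vf_bracket M' P Q (\<phi> a) \<in> H' (w + w' - 1) (\<phi> a)"
proof -
  \<comment> \<open>\<open>A\<close> is the derivative in the direction \<open>X a\<close> of the
    section along \<phi> built from \<open>Y\<close> and \<open>Q\<close>; \<open>B\<close>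
    exchanges the roles.\<close>
  define A where "A f = (if smooth_near M' (\<phi> a) f
      then X a (\<lambda>x. Y x (f \<circ> \<phi>)) - X a (\<lambda>x. Q (\<phi> x) f) else 0)" for f
  define B where "B f = (if smooth_near M' (\<phi> a) f
      then Y a (\<lambda>x. X x (f \<circ> \<phi>)) - Y a (\<lambda>x. P (\<phi> x) f) else 0)" for f
  have "X a \<in> tangent_space M a" "Y a \<in> tangent_space M a"
    using X Y U by (auto simp: bundle_section_def vector_field_def)
  then have "A \<in> H' w' (\<phi> a)" "B \<in> H' w (\<phi> a)"
    using derivative_difference_in_subbundle[OF w(2) _ _ U Y V Q YQ]
      derivative_difference_in_subbundle[OF w(1) _ _ U X V P XP] w
    unfolding A_def[abs_def] B_def[abs_def] by auto
  \<comment> \<open>Both degrees are at least 1, so neither exceeds \<open>w + w' - 1\<close>; this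
    is the source of the gain of one filtration degree.\<close>
  moreover have "w \<le> w + w' - 1" "w' \<le> w + w' - 1" "w + w' - 1 \<le> r" using w by auto
  note le = this
  note mono = carnot_mono[OF carnot' carnot_map_topspace[OF map a] _ le(3)]
  ultimately have AB: "A - B \<in> H' (w + w' - 1) (\<phi> a)"
    using mono[OF le(1)] mono[OF le(2)]
      subspace_diff[OF carnot_subspace[OF carnot' carnot_map_topspace[OF map a] le(3)]] by blast
  have "(differential M' \<phi> a (vf_bracket M X Y a) - vf_bracket M' P Q (\<phi> a)) f = (A - B) f" for f
  proof (cases "smooth_near M' (\<phi> a) f")
    case True
    have "smooth_near M a (f \<circ> \<phi>)"
      using smooth_near_compose[OF carnot_smooth[OF carnot] carnot_smooth[OF carnot'] carnot_map_smooth[OF map] a True]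
      by (simp add: comp_def)
    moreover have "smooth_near M' (\<phi> a) (\<lambda>y. Q y f)" "smooth_near M' (\<phi> a) (\<lambda>y. P y f)"
      using P Q V True by (auto simp: bundle_section_def intro: vector_field_smooth_near)
    \<comment> \<open>\<open>XP\<close> turns \<open>P (\<phi> a)\<close> applied to
      \<open>Q y f\<close> into \<open>X a\<close> applied to its pullback, and \<open>YQ\<close>
      treats the other term in the same way.\<close>
    ultimately show ?thesis
      using True fun_cong[OF XP, of "\<lambda>y. Q y f"] fun_cong[OF YQ, of "\<lambda>y. P y f"]
      by (simp add: A_def B_def differential_def vf_bracket_def comp_def)
  qed (simp add: A_def B_def differential_def vf_bracket_def)
  then have "differential M' \<phi> a (vf_bracket M X Y a) - vf_bracket M' P Q (\<phi> a) = A - B"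
    by (rule ext)
  then show ?thesis using AB by simp
qed

end

lemma vf_bracket_add_left:
  assumes M: "smooth_manifold M" and U: "openin (mtop M) U" "x \<in> U"
    and "vector_field M U X" "vector_field M U X'" and Y: "Y x \<in> tangent_space M x"
  shows "vf_bracket M (\<lambda>y. X y + X' y) Y x = vf_bracket M X Y x + vf_bracket M X' Y x"
proof
  fix f
  show "vf_bracket M (\<lambda>y. X y + X' y) Y x f = (vf_bracket M X Y x + vf_bracket M X' Y x) f"
  proof (cases "smooth_near M x f")
    case True
    then show ?thesis
      using tangent_add[OF Y vector_field_smooth_near[OF assms(4) U True]
          vector_field_smooth_near[OF assms(5) U True]]
      by (simp add: vf_bracket_def)
  qed (simp add: vf_bracket_def)
qed

text \<open>The hypotheses constrain only the classes of the vectors in the graded pieces, which is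
  the form that \<open>gr_bracket\<close> requires.\<close>

lemma bracket_congruence:
  fixes M :: "('a, 'e::real_inner) mfd" and M' :: "('b, 'f::real_inner) mfd"
  assumes carnot: "carnot_manifold r M H" and carnot': "carnot_manifold r M' H'"
    and map: "carnot_map r M H M' H' \<phi>" and a: "a \<in> topspace (mtop M)"
    and w: "1 \<le> w" "1 \<le> w'" "w + w' \<le> r"
    and U: "openin (mtop M) U" "a \<in> U"
    and X: "bundle_section M (H w) U X" and Y: "bundle_section M (H w') U Y"
    and V: "openin (mtop M') V" "\<phi> a \<in> V"
    and X': "bundle_section M' (H' w) V X'" and Y': "bundle_section M' (H' w') V Y'"
    and XX': "differential M' \<phi> a (X a) - X' (\<phi> a) \<in> H' (w - 1) (\<phi> a)"
    and YY': "differential M' \<phi> a (Y a) - Y' (\<phi> a) \<in> H' (w' - 1) (\<phi> a)"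
  shows "differential M' \<phi> a (vf_bracket M X Y a) - vf_bracket M' X' Y' (\<phi> a)
    \<in> H' (w + w' - 1) (\<phi> a)"
proof -
  note M' = carnot_smooth[OF carnot']
  have b: "\<phi> a \<in> topspace (mtop M')" by (rule carnot_map_topspace[OF map a])
  have le: "w - 1 \<le> r" "w' - 1 \<le> r" "w + w' - 1 \<le> r" using w by auto
  \<comment> \<open>The discrepancies at \<open>\<phi> a\<close> are extended to fields of one
    degree lower; adding them to \<open>X'\<close> and \<open>Y'\<close> brings the exact case into
    play.\<close>
  obtain V1 X'' where V1: "openin (mtop M') V1" "\<phi> a \<in> V1"
    and X'': "bundle_section M' (H' (w - 1)) V1 X''"
    and X''_eq: "X'' (\<phi> a) = differential M' \<phi> a (X a) - X' (\<phi> a)"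
    by (rule carnot_section_extension[OF carnot' b le(1) XX'])
  obtain V2 Y'' where V2: "openin (mtop M') V2" "\<phi> a \<in> V2"
    and Y'': "bundle_section M' (H' (w' - 1)) V2 Y''"
    and Y''_eq: "Y'' (\<phi> a) = differential M' \<phi> a (Y a) - Y' (\<phi> a)"
    by (rule carnot_section_extension[OF carnot' b le(2) YY'])
  define N where "N = V \<inter> V1 \<inter> V2"
  have N: "openin (mtop M') N" "\<phi> a \<in> N" using V V1 V2 by (auto simp: N_def)
  have sections: "bundle_section M' (H' w) N X'" "bundle_section M' (H' w') N Y'"
    "bundle_section M' (H' (w - 1)) N X''" "bundle_section M' (H' (w' - 1)) N Y''"
    by (rule bundle_section_subset[OF X'] bundle_section_subset[OF Y']
        bundle_section_subset[OF X''] bundle_section_subset[OF Y''], force simp: N_def)+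
  have sum_section: "bundle_section M' (H' v) N (\<lambda>y. S y + S' y)"
    if S: "bundle_section M' (H' v) N S" "bundle_section M' (H' (v - 1)) N S'" and v: "v \<le> r" for v S S'
    unfolding bundle_section_def
  proof
    show "vector_field M' N (\<lambda>y. S y + S' y)"
      using S by (intro vector_field_add[OF M']) (auto simp: bundle_section_def)
    show "\<forall>y\<in>N. S y + S' y \<in> H' v y"
    proof
      fix y assume y: "y \<in> N"
      have top: "y \<in> topspace (mtop M')" using openin_subset[OF N(1)] y by auto
      have "S y \<in> H' v y" "S' y \<in> H' v y"
        using S y carnot_mono[OF carnot' top diff_le_self v] by (auto simp: bundle_section_def)
      then show "S y + S' y \<in> H' v y" by (rule subspace_add[OF carnot_subspace[OF carnot' top v]])
    qed
  qed
  define P where "P y = X' y + X'' y" for y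
  define Q where "Q y = Y' y + Y'' y" for y
  have P: "bundle_section M' (H' w) N P" and Q: "bundle_section M' (H' w') N Q"
    using sum_section[OF sections(1,3)] sum_section[OF sections(2,4)] w
    unfolding P_def[abs_def] Q_def[abs_def] by auto
  have exact: "differential M' \<phi> a (vf_bracket M X Y a) - vf_bracket M' P Q (\<phi> a)
      \<in> H' (w + w' - 1) (\<phi> a)"
    by (rule bracket_congruence_exact[OF carnot carnot' map a w U X Y N P Q])
      (simp_all add: P_def Q_def X''_eq Y''_eq)
  have tan: "Q (\<phi> a) \<in> tangent_space M' (\<phi> a)" "X' (\<phi> a) \<in> tangent_space M' (\<phi> a)"
    using Q sections(1) N(2) by (auto simp: bundle_section_def vector_field_def)
  have "vf_bracket M' P Q (\<phi> a) = vf_bracket M' X' Q (\<phi> a) + vf_bracket M' X'' Q (\<phi> a)"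
    using sections tan unfolding P_def[abs_def]
    by (intro vf_bracket_add_left[OF M' N]) (auto simp: bundle_section_def)
  moreover have "vf_bracket M' Q X' (\<phi> a) = vf_bracket M' Y' X' (\<phi> a) + vf_bracket M' Y'' X' (\<phi> a)"
    using sections tan unfolding Q_def[abs_def]
    by (intro vf_bracket_add_left[OF M' N]) (auto simp: bundle_section_def)
  \<comment> \<open>Expanding both arguments leaves the error terms \<open>[X'', Q]\<close> and
    \<open>[X', Y'']\<close>, the second one rewritten by antisymmetry. Each has one argument of
    lowered degree, so \<open>carnot_bracket\<close> puts it in degree
    \<open>w + w' - 1\<close>.\<close>
  ultimately have "differential M' \<phi> a (vf_bracket M X Y a) - vf_bracket M' X' Y' (\<phi> a) =
      (differential M' \<phi> a (vf_bracket M X Y a) - vf_bracket M' P Q (\<phi> a)) +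
      (vf_bracket M' X'' Q (\<phi> a) - vf_bracket M' Y'' X' (\<phi> a))"
    using vf_bracket_swap[of M' X' Q "\<phi> a"] vf_bracket_swap[of M' X' Y' "\<phi> a"] by simp
  moreover have "vf_bracket M' X'' Q (\<phi> a) \<in> H' (w + w' - 1) (\<phi> a)"
    using carnot_bracket[OF carnot' _ _ N sections(3) Q] w by simp
  moreover have "vf_bracket M' Y'' X' (\<phi> a) \<in> H' (w + w' - 1) (\<phi> a)"
    using carnot_bracket[OF carnot' _ _ N sections(4,1)] w by (simp add: add.commute)
  ultimately show ?thesis
    using exact subspace_add[OF carnot_subspace[OF carnot' b le(3)]]
      subspace_diff[OF carnot_subspace[OF carnot' b le(3)]] by metis
qed

text \<open>On non-smooth functions \<open>differential\<close> yields 0, and a tangent vector does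
  so as well.\<close>

lemma differential_id:
  assumes "u \<in> tangent_space M x"
  shows "differential M id x u = u"
  by (rule ext) (simp add: differential_def tangent_not_smooth[OF assms])

text \<open>With this map \<open>bracket_congruence\<close> compares two choices of sections on the
  same manifold. Smoothness of the identity is smoothness of the transition maps.\<close>

lemma carnot_map_id:
  assumes "carnot_manifold r M H"
  shows "carnot_map r M H M H id"
  unfolding carnot_map_def
proof (intro conjI ballI)
  have "\<forall>(U, c)\<in>atlas M. \<forall>(V, d)\<in>atlas M. smooth_on (c ` (U \<inter> V)) (d \<circ> inv_into U c)"
    using carnot_smooth[OF assms] unfolding smooth_manifold_def by blast
  then show "smooth_map M M id" by (simp add: smooth_map_def)
next
  fix x j assume x: "x \<in> topspace (mtop M)" and "j \<in> {1..r}"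
  then have "H j x \<subseteq> tangent_space M x" using carnot_tangent[OF assms x, of j] by simp
  then show "differential M id x ` H j x \<subseteq> H j (id x)"
    using differential_id[of _ M x] by (simp add: image_subset_iff subset_iff)
qed

section \<open>Cosets in a filtration and their operations\<close>

context
  fixes H :: "nat \<Rightarrow> 'a \<Rightarrow> 'a tvec set" and w a
  assumes sub: "subspace (H w a)" "subspace (H (w - 1) a)" "H (w - 1) a \<subseteq> H w a"
begin

lemma gr_class_eqI:
  assumes "u - v \<in> H (w - 1) a"
  shows "gr_class H w a u = gr_class H w a v"
proof -
  have "x - u \<in> H (w - 1) a \<longleftrightarrow> x - v \<in> H (w - 1) a" for x
    using subspace_add[OF sub(2) _ assms, of "x - u"] subspace_diff[OF sub(2) _ assms, of "x - v"]
    by auto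
  then show ?thesis by (auto simp: gr_class_def)
qed

lemma gr_class_self: "u \<in> H w a \<Longrightarrow> u \<in> gr_class H w a u"
  using subspace_0[OF sub(2)] by (simp add: gr_class_def)

lemma gr_class_eqD:
  assumes "gr_class H w a u = gr_class H w a v" "u \<in> H w a"
  shows "u - v \<in> H (w - 1) a"
  using gr_class_self[OF assms(2)] unfolding assms(1) by (simp add: gr_class_def)

text \<open>Operations on cosets are unions over all representatives; such a union collapses to one
  value when \<open>F\<close> is constant on the nonempty coset.\<close>

lemma gr_class_UN:
  assumes "u \<in> H w a" "\<And>v. v \<in> H w a \<Longrightarrow> v - u \<in> H (w - 1) a \<Longrightarrow> F v = F u"
  shows "(\<Union>v\<in>gr_class H w a u. F v) = F u"
  by (rule UN_constant_eq[OF gr_class_self[OF assms(1)]]) (simp add: gr_class_def assms(2))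

lemma gr_add_class:
  assumes "u \<in> H w a" "v \<in> H w a"
  shows "gr_add H w a (gr_class H w a u) (gr_class H w a v) = gr_class H w a (u + v)"
proof -
  have "(\<Union>y\<in>gr_class H w a v. gr_class H w a (x + y)) = gr_class H w a (x + v)" for x
    by (rule gr_class_UN[OF assms(2)]) (simp add: gr_class_eqI)
  moreover have "(\<Union>x\<in>gr_class H w a u. gr_class H w a (x + v)) = gr_class H w a (u + v)"
    by (rule gr_class_UN[OF assms(1)]) (simp add: gr_class_eqI)
  ultimately show ?thesis by (simp add: gr_add_def)
qed

lemma gr_scale_class:
  assumes "u \<in> H w a"
  shows "gr_scale H w a c (gr_class H w a u) = gr_class H w a (c *\<^sub>R u)"
  unfolding gr_scale_def
proof (rule gr_class_UN[OF assms])
  fix v assume "v - u \<in> H (w - 1) a"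
  then have "c *\<^sub>R v - c *\<^sub>R u \<in> H (w - 1) a"
    unfolding scaleR_diff_right[symmetric] by (rule subspace_scale[OF sub(2)])
  then show "gr_class H w a (c *\<^sub>R v) = gr_class H w a (c *\<^sub>R u)" by (rule gr_class_eqI)
qed

lemma gr_classI: "u \<in> H w a \<Longrightarrow> gr_class H w a u \<in> gr H w a"
  by (simp add: gr_def)

lemma gr_comm_monoid:
  "comm_monoid \<lparr>carrier = gr H w a, monoid.mult = gr_add H w a, one = gr_class H w a 0\<rparr>"
proof (rule comm_monoidI; simp)
  show "gr_class H w a 0 \<in> gr H w a" using gr_classI subspace_0[OF sub(1)] by blast
qed (auto simp: gr_def gr_add_class subspace_add[OF sub(1)] subspace_0[OF sub(1)] ac_simps)

lemma gr_scale_closed: "A \<in> gr H w a \<Longrightarrow> gr_scale H w a c A \<in> gr H w a"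
  by (auto simp: gr_def gr_scale_class subspace_scale[OF sub(1)])

end

lemma carnot_graded:
  assumes "carnot_manifold r M H" "a \<in> topspace (mtop M)" "w \<le> r"
  shows "subspace (H w a)" "subspace (H (w - 1) a)" "H (w - 1) a \<subseteq> H w a"
  using assms carnot_subspace[OF assms(1,2)] carnot_mono[OF assms(1,2)] by simp_all

text \<open>The definite description is justified because two choices of sections with the same
  classes have brackets that agree modulo degree \<open>w + w' - 1\<close>, by
  \<open>bracket_congruence\<close> for the identity map.\<close>

lemma gr_bracket_class:
  fixes M :: "('a, 'e::real_inner) mfd"
  assumes carnot: "carnot_manifold r M H" and w: "1 \<le> w" "1 \<le> w'" "w + w' \<le> r"
    and U: "openin (mtop M) U" "a \<in> U"
    and X: "bundle_section M (H w) U X" and Y: "bundle_section M (H w') U Y"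
  shows "gr_bracket M H a w w' (gr_class H w a (X a)) (gr_class H w' a (Y a)) =
    gr_class H (w + w') a (vf_bracket M X Y a)"
  unfolding gr_bracket_def
proof (rule the_equality)
  show "\<exists>U' X' Y'. openin (mtop M) U' \<and> a \<in> U' \<and>
      bundle_section M (H w) U' X' \<and> bundle_section M (H w') U' Y' \<and>
      gr_class H w a (X a) = gr_class H w a (X' a) \<and> gr_class H w' a (Y a) = gr_class H w' a (Y' a) \<and>
      gr_class H (w + w') a (vf_bracket M X Y a) = gr_class H (w + w') a (vf_bracket M X' Y' a)"
    using U X Y by blast
next
  fix C
  assume "\<exists>U' X' Y'. openin (mtop M) U' \<and> a \<in> U' \<and>
      bundle_section M (H w) U' X' \<and> bundle_section M (H w') U' Y' \<and>
      gr_class H w a (X a) = gr_class H w a (X' a) \<and> gr_class H w' a (Y a) = gr_class H w' a (Y' a) \<and>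
      C = gr_class H (w + w') a (vf_bracket M X' Y' a)"
  then obtain U' X' Y' where U': "openin (mtop M) U'" "a \<in> U'"
    and X': "bundle_section M (H w) U' X'" and Y': "bundle_section M (H w') U' Y'"
    and cX: "gr_class H w a (X a) = gr_class H w a (X' a)"
    and cY: "gr_class H w' a (Y a) = gr_class H w' a (Y' a)"
    and C: "C = gr_class H (w + w') a (vf_bracket M X' Y' a)" by blast
  have a: "a \<in> topspace (mtop M)" using openin_subset[OF U(1)] U(2) by auto
  note id = differential_id[of _ M a]
  have Xa: "X a \<in> H w a" "Y a \<in> H w' a" using X Y U(2) by (auto simp: bundle_section_def)
  have tan: "X a \<in> tangent_space M a" "Y a \<in> tangent_space M a"
    using X Y U(2) by (auto simp: bundle_section_def vector_field_def)
  have "vf_bracket M X Y a \<in> H (w + w') a" by (rule carnot_bracket[OF carnot w(2,3) U X Y])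
  then have tan': "vf_bracket M X Y a \<in> tangent_space M a"
    using carnot_tangent[OF carnot a w(3)] by blast
  have "w \<le> r" "w' \<le> r" using w by auto
  then have "X a - X' a \<in> H (w - 1) a" "Y a - Y' a \<in> H (w' - 1) a"
    using gr_class_eqD[OF carnot_graded[OF carnot a] cX Xa(1)]
      gr_class_eqD[OF carnot_graded[OF carnot a] cY Xa(2)] by auto
  then have "differential M id a (vf_bracket M X Y a) - vf_bracket M X' Y' (id a) \<in> H (w + w' - 1) (id a)"
    using U' id[OF tan(1)] id[OF tan(2)]
    by (intro bracket_congruence[OF carnot carnot carnot_map_id[OF carnot] a w U X Y _ _ X' Y']) simp_all
  then have "vf_bracket M X Y a - vf_bracket M X' Y' a \<in> H (w + w' - 1) a"
    using id[OF tan'] by simp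
  then show "C = gr_class H (w + w') a (vf_bracket M X Y a)"
    unfolding C by (intro gr_class_eqI[of H "w + w'" a, OF carnot_graded[OF carnot a w(3)], symmetric])
qed

subsection \<open>The graded algebra and the tangent group\<close>

text \<open>\<open>hom\<close> asks only for compatibility with products, so the unit is treated
  separately; it is the value on the empty index set and the default of \<open>finprod\<close> on an
  infinite one.\<close>

lemma finprod_hom:
  assumes G: "comm_monoid G" and G': "comm_monoid G'"
    and h: "h \<in> hom G G'" "h \<one>\<^bsub>G\<^esub> = \<one>\<^bsub>G'\<^esub>" and f: "f \<in> I \<rightarrow> carrier G"
  shows "h (finprod G f I) = finprod G' (\<lambda>i. h (f i)) I"
  using f
proof (induction I rule: infinite_finite_induct)
  case (infinite I)
  then show ?case
    using h(2) by (simp add: comm_monoid.finprod_infinite[OF G] comm_monoid.finprod_infinite[OF G'])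
next
  case empty
  then show ?case
    using h(2) by (simp add: comm_monoid.finprod_empty[OF G] comm_monoid.finprod_empty[OF G'])
next
  case (insert i I)
  then have I: "f \<in> I \<rightarrow> carrier G" "f i \<in> carrier G" by auto
  then have hI: "(\<lambda>i. h (f i)) \<in> I \<rightarrow> carrier G'" "h (f i) \<in> carrier G'"
    using h(1) by (auto simp: hom_def)
  have "h (finprod G f (insert i I)) = h (f i) \<otimes>\<^bsub>G'\<^esub> h (finprod G f I)"
    using comm_monoid.finprod_insert[OF G insert(1,2) I] hom_mult[OF h(1) I(2)]
      comm_monoid.finprod_closed[OF G I(1)] by simp
  then show ?case
    using comm_monoid.finprod_insert[OF G' insert(1,2) hI] insert.IH[OF I(1)] by simp
qed

text \<open>The Dynkin product is assembled from sums, scalar multiples and nested brackets with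
  coefficients that do not depend on the algebra, so it is preserved term by term.\<close>

lemma dynkin_group_hom:
  assumes L: "comm_monoid \<lparr>carrier = carrier L, monoid.mult = ladd L, one = lzero L\<rparr>"
    and L': "comm_monoid \<lparr>carrier = carrier L', monoid.mult = ladd L', one = lzero L'\<rparr>"
    and scale: "\<And>c x. x \<in> carrier L \<Longrightarrow> lscale L c x \<in> carrier L"
    and br: "\<And>x y. x \<in> carrier L \<Longrightarrow> y \<in> carrier L \<Longrightarrow> lbr L x y \<in> carrier L"
    and h: "h \<in> lie_alg_hom L L'" and h0: "h (lzero L) = lzero L'"
  shows "h \<in> hom (dynkin_group r L) (dynkin_group r L')"
proof -
  have closed: "h x \<in> carrier L'" if "x \<in> carrier L" for x using h that by (auto simp: lie_alg_hom_def)
  have zero: "lzero L \<in> carrier L" using monoid.one_closed[OF comm_monoid.axioms(1)[OF L]] by simp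
  \<comment> \<open>Closure is proved together with compatibility, because \<open>h\<close> respects
    a bracket only when both arguments lie in the carrier.\<close>
  have nested: "nested_bracket L xs \<in> carrier L \<and> h (nested_bracket L xs) = nested_bracket L' (map h xs)"
    if "set xs \<subseteq> carrier L" for xs
    using that
  proof (induction xs rule: induct_list012)
    case (3 x y zs)
    then have IH: "nested_bracket L (y # zs) \<in> carrier L"
      "h (nested_bracket L (y # zs)) = nested_bracket L' (map h (y # zs))" by auto
    have "h (lbr L x (nested_bracket L (y # zs))) = lbr L' (h x) (h (nested_bracket L (y # zs)))"
      using h IH(1) 3 by (simp add: lie_alg_hom_def)
    then show ?case using br[OF _ IH(1)] IH(2) 3 by simp
  qed (simp_all add: zero h0)
  have word: "map h (dynkin_word x y pq) = dynkin_word (h x) (h y) pq" for x y pq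
    by (induction pq) (auto simp: dynkin_word_def)
  have word_closed: "set (dynkin_word x y pq) \<subseteq> carrier L" if "x \<in> carrier L" "y \<in> carrier L" for x y pq
    using that by (auto simp: dynkin_word_def)
  have "h (dynkin_product r L x y) = dynkin_product r L' (h x) (h y)"
    if xy: "x \<in> carrier L" "y \<in> carrier L" for x y
  proof -
    note nested_xy = nested[OF word_closed[OF xy]]
    have "h (dynkin_product r L x y) = lsum L'
        (\<lambda>pq. h (lscale L (dynkin_coeff pq) (nested_bracket L (dynkin_word x y pq)))) (dynkin_index r)"
      unfolding dynkin_product_def lsum_def
      using h h0 nested_xy by (intro finprod_hom[OF L L']) (auto simp: hom_def lie_alg_hom_def scale)
    also have "(\<lambda>pq. h (lscale L (dynkin_coeff pq) (nested_bracket L (dynkin_word x y pq)))) =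
        (\<lambda>pq. lscale L' (dynkin_coeff pq) (nested_bracket L' (dynkin_word (h x) (h y) pq)))"
      using h nested_xy by (auto simp: lie_alg_hom_def word)
    finally show ?thesis by (simp add: dynkin_product_def)
  qed
  then show ?thesis using closed by (simp add: hom_def dynkin_group_def)
qed

section \<open>Algebraic operations on the graded algebra at a point\<close>

context
  fixes r and M :: "('a, 'e::real_inner) mfd" and H a
  assumes carnot: "carnot_manifold r M H" and a: "a \<in> topspace (mtop M)"
begin

text \<open>Representatives extend to sections over two neighbourhoods; restriction to the
  intersection gives the common domain that \<open>gr_bracket_class\<close> asks for.\<close>

lemma gr_bracket_sections:
  assumes w: "1 \<le> w" "1 \<le> w'" "w + w' \<le> r" and "A \<in> gr H w a" "B \<in> gr H w' a"
  obtains U X Y where "openin (mtop M) U" "a \<in> U"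
    and "bundle_section M (H w) U X" "bundle_section M (H w') U Y"
    and "A = gr_class H w a (X a)" "B = gr_class H w' a (Y a)"
proof -
  obtain u v where uv: "u \<in> H w a" "A = gr_class H w a u" "v \<in> H w' a" "B = gr_class H w' a v"
    using assms(4,5) by (auto simp: gr_def)
  have le: "w \<le> r" "w' \<le> r" using w by auto
  obtain U X where U: "openin (mtop M) U" "a \<in> U" "bundle_section M (H w) U X" "X a = u"
    by (rule carnot_section_extension[OF carnot a le(1) uv(1)])
  obtain V Y where V: "openin (mtop M) V" "a \<in> V" "bundle_section M (H w') V Y" "Y a = v"
    by (rule carnot_section_extension[OF carnot a le(2) uv(3)])
  show thesis
    using U V uv
    by (intro that[of "U \<inter> V" X Y] bundle_section_subset[OF U(3)] bundle_section_subset[OF V(3)]) auto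
qed

lemma gr_bracket_closed:
  assumes w: "1 \<le> w" "1 \<le> w'" "w + w' \<le> r" and AB: "A \<in> gr H w a" "B \<in> gr H w' a"
  shows "gr_bracket M H a w w' A B \<in> gr H (w + w') a"
proof (rule gr_bracket_sections[OF w AB])
  fix U X Y
  assume U: "openin (mtop M) U" "a \<in> U"
    and XY: "bundle_section M (H w) U X" "bundle_section M (H w') U Y"
    and "A = gr_class H w a (X a)" "B = gr_class H w' a (Y a)"
  then have "gr_bracket M H a w w' A B = gr_class H (w + w') a (vf_bracket M X Y a)"
    using gr_bracket_class[OF carnot w U XY] by simp
  moreover have "vf_bracket M X Y a \<in> H (w + w') a" by (rule carnot_bracket[OF carnot w(2,3) U XY])
  ultimately show ?thesis by (simp add: gr_def)
qed

lemma carnot_gr_comm_monoid: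
  "w \<le> r \<Longrightarrow>
    comm_monoid \<lparr>carrier = gr H w a, monoid.mult = gr_add H w a, one = gr_class H w a 0\<rparr>"
  by (rule gr_comm_monoid[of H w a]) (rule carnot_graded[OF carnot a], assumption)+

lemma osc_algebra_comm_monoid:
  "comm_monoid \<lparr>carrier = carrier (osc_algebra r M H a), monoid.mult = ladd (osc_algebra r M H a),
    one = lzero (osc_algebra r M H a)\<rparr>"
proof -
  let ?G = "\<lambda>w. \<lparr>carrier = gr H w a, monoid.mult = gr_add H w a, one = gr_class H w a 0\<rparr>"
  have cm: "comm_monoid (?G w)" if "w \<in> {1..r}" for w using carnot_gr_comm_monoid[of w] that by simp
  have m: "monoid (?G w)" if "w \<in> {1..r}" for w using cm[OF that] by (rule comm_monoid.axioms(1))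
  show ?thesis
  proof (rule comm_monoidI; simp only: partial_object.simps monoid.simps)
    fix x y z
    assume x: "x \<in> carrier (osc_algebra r M H a)" and y: "y \<in> carrier (osc_algebra r M H a)"
    show "ladd (osc_algebra r M H a) x y \<in> carrier (osc_algebra r M H a)"
      using x y monoid.m_closed[OF m] by (auto simp: osc_algebra_def PiE_iff)
    show "ladd (osc_algebra r M H a) x y = ladd (osc_algebra r M H a) y x"
      using x y comm_monoid.m_comm[OF cm] by (auto simp: osc_algebra_def PiE_iff intro!: restrict_ext)
    \<comment> \<open>Elements of the carrier are extensional functions, so outside
      \<open>{1..r}\<close> both sides are \<open>undefined\<close>.\<close>
    show "ladd (osc_algebra r M H a) (lzero (osc_algebra r M H a)) x = x"
    proof (rule extensionalityI[of _ "{1..r}"])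
      fix w assume w: "w \<in> {1..r}"
      then show "ladd (osc_algebra r M H a) (lzero (osc_algebra r M H a)) x w = x w"
        using x monoid.l_one[OF m[OF w]] by (auto simp: osc_algebra_def PiE_iff)
    qed (use x in \<open>auto simp: osc_algebra_def PiE_iff\<close>)
    assume z: "z \<in> carrier (osc_algebra r M H a)"
    show "ladd (osc_algebra r M H a) (ladd (osc_algebra r M H a) x y) z =
        ladd (osc_algebra r M H a) x (ladd (osc_algebra r M H a) y z)"
      using x y z monoid.m_assoc[OF m] by (auto simp: osc_algebra_def PiE_iff intro!: restrict_ext)
  next
    show "lzero (osc_algebra r M H a) \<in> carrier (osc_algebra r M H a)"
      using monoid.one_closed[OF m] by (auto simp: osc_algebra_def)
  qed
qed

lemma osc_algebra_scale_closed:
  assumes "x \<in> carrier (osc_algebra r M H a)"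
  shows "lscale (osc_algebra r M H a) c x \<in> carrier (osc_algebra r M H a)"
proof -
  have "gr_scale H w a c (x w) \<in> gr H w a" if "w \<in> {1..r}" for w
    using that assms carnot_graded[OF carnot a, of w]
    by (intro gr_scale_closed[of H w a]) (auto simp: osc_algebra_def PiE_iff)
  then show ?thesis by (simp add: osc_algebra_def)
qed

lemma osc_algebra_gr_bracket_closed:
  assumes "x \<in> carrier (osc_algebra r M H a)" "y \<in> carrier (osc_algebra r M H a)"
    and "k \<le> r" "w \<in> {1..<k}"
  shows "gr_bracket M H a w (k - w) (x w) (y (k - w)) \<in> gr H k a"
  using gr_bracket_closed[of w "k - w" "x w" "y (k - w)"] assms by (auto simp: osc_algebra_def PiE_iff)

lemma osc_algebra_bracket_closed:
  assumes "x \<in> carrier (osc_algebra r M H a)" "y \<in> carrier (osc_algebra r M H a)"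
  shows "lbr (osc_algebra r M H a) x y \<in> carrier (osc_algebra r M H a)"
proof -
  have "gr_sum H k a (\<lambda>w. gr_bracket M H a w (k - w) (x w) (y (k - w))) {1..<k} \<in> gr H k a"
    if "k \<in> {1..r}" for k
  proof -
    let ?G = "\<lparr>carrier = gr H k a, monoid.mult = gr_add H k a, one = gr_class H k a 0\<rparr>"
    have k: "k \<le> r" using that by simp
    have "(\<lambda>w. gr_bracket M H a w (k - w) (x w) (y (k - w))) \<in> {1..<k} \<rightarrow> carrier ?G"
      using osc_algebra_gr_bracket_closed[OF assms k] by simp
    then show ?thesis
      using comm_monoid.finprod_closed[OF carnot_gr_comm_monoid[OF k]] by (simp add: gr_sum_def)
  qed
  then show ?thesis by (simp add: osc_algebra_def)
qed

end

section \<open>The Carnot differential, first on one graded piece and then on the sum\<close>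

definition gr_map ::
  "('b, 'f::real_inner) mfd \<Rightarrow> (nat \<Rightarrow> 'b \<Rightarrow> 'b tvec set) \<Rightarrow> ('a \<Rightarrow> 'b) \<Rightarrow> 'a \<Rightarrow> nat \<Rightarrow>
   'a tvec set \<Rightarrow> 'b tvec set" where
  "gr_map M' H' \<phi> a w A = (\<Union>u\<in>A. gr_class H' w (\<phi> a) (differential M' \<phi> a u))"

lemma carnot_differential_eq_gr_map:
  "carnot_differential r M' H' \<phi> a \<xi> = (\<lambda>w\<in>{1..r}. gr_map M' H' \<phi> a w (\<xi> w))"
  by (simp add: carnot_differential_def gr_map_def)

lemma differential_add: "differential M' \<phi> a (u + v) = differential M' \<phi> a u + differential M' \<phi> a v"
  by (auto simp: differential_def)

lemma differential_diff: "differential M' \<phi> a (u - v) = differential M' \<phi> a u - differential M' \<phi> a v"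
  by (auto simp: differential_def)

lemma differential_scale: "differential M' \<phi> a (c *\<^sub>R u) = c *\<^sub>R differential M' \<phi> a u"
  by (auto simp: differential_def scaleR_fun_def)

lemma differential_zero: "differential M' \<phi> a 0 = 0"
  by (auto simp: differential_def)

context
  fixes r H H' \<phi> a and M :: "('a, 'e::real_inner) mfd" and M' :: "('b, 'f::real_inner) mfd"
  assumes carnot: "carnot_manifold r M H" and carnot': "carnot_manifold r M' H'"
    and map: "carnot_map r M H M' H' \<phi>" and a: "a \<in> topspace (mtop M)"
begin

text \<open>The result does not depend on the representative because the differential also sends
  \<open>H (w - 1) a\<close> into \<open>H' (w - 1) (\<phi> a)\<close>.\<close>

lemma gr_map_class:
  assumes w: "w \<le> r" and u: "u \<in> H w a"
  shows "gr_map M' H' \<phi> a w (gr_class H w a u) = gr_class H' w (\<phi> a) (differential M' \<phi> a u)"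
  unfolding gr_map_def
proof (rule gr_class_UN[of H w a, OF carnot_graded[OF carnot a w] u])
  fix v assume "v - u \<in> H (w - 1) a"
  then have "differential M' \<phi> a v - differential M' \<phi> a u \<in> H' (w - 1) (\<phi> a)"
    using carnot_map_differential[OF carnot carnot' map a, of "w - 1" "v - u"] w
    by (simp add: differential_diff)
  then show "gr_class H' w (\<phi> a) (differential M' \<phi> a v) = gr_class H' w (\<phi> a) (differential M' \<phi> a u)"
    by (rule gr_class_eqI[of H' w "\<phi> a", OF carnot_graded[OF carnot' carnot_map_topspace[OF map a] w]])
qed

lemma gr_map_closed: "w \<le> r \<Longrightarrow> A \<in> gr H w a \<Longrightarrow> gr_map M' H' \<phi> a w A \<in> gr H' w (\<phi> a)"
  using carnot_map_differential[OF carnot carnot' map a] by (auto simp: gr_def gr_map_class)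

lemma gr_map_zero: "w \<le> r \<Longrightarrow> gr_map M' H' \<phi> a w (gr_class H w a 0) = gr_class H' w (\<phi> a) 0"
  using gr_map_class[of w 0] subspace_0[OF carnot_subspace[OF carnot a]]
  by (simp add: differential_zero)

lemma gr_map_add:
  assumes w: "w \<le> r" and "A \<in> gr H w a" "B \<in> gr H w a"
  shows "gr_map M' H' \<phi> a w (gr_add H w a A B) =
    gr_add H' w (\<phi> a) (gr_map M' H' \<phi> a w A) (gr_map M' H' \<phi> a w B)"
proof -
  obtain u v where uv: "u \<in> H w a" "A = gr_class H w a u" "v \<in> H w a" "B = gr_class H w a v"
    using assms(2,3) by (auto simp: gr_def)
  have "u + v \<in> H w a" using uv by (intro subspace_add[OF carnot_subspace[OF carnot a w]])
  then show ?thesis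
    using uv gr_add_class[of H w a, OF carnot_graded[OF carnot a w], of u v]
      gr_add_class[of H' w "\<phi> a", OF carnot_graded[OF carnot' carnot_map_topspace[OF map a] w],
        of "differential M' \<phi> a u" "differential M' \<phi> a v"]
      carnot_map_differential[OF carnot carnot' map a w]
    by (simp add: gr_map_class[OF w] differential_add)
qed

lemma gr_map_scale:
  assumes w: "w \<le> r" and "A \<in> gr H w a"
  shows "gr_map M' H' \<phi> a w (gr_scale H w a c A) = gr_scale H' w (\<phi> a) c (gr_map M' H' \<phi> a w A)"
proof -
  obtain u where u: "u \<in> H w a" "A = gr_class H w a u" using assms(2) by (auto simp: gr_def)
  have "c *\<^sub>R u \<in> H w a" using u by (intro subspace_scale[OF carnot_subspace[OF carnot a w]])
  then show ?thesis
    using u gr_scale_class[of H w a, OF carnot_graded[OF carnot a w], of u c]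
      gr_scale_class[of H' w "\<phi> a", OF carnot_graded[OF carnot' carnot_map_topspace[OF map a] w],
        of "differential M' \<phi> a u" c]
      carnot_map_differential[OF carnot carnot' map a w]
    by (simp add: gr_map_class[OF w] differential_scale)
qed

text \<open>The fields \<open>X'\<close> and \<open>Y'\<close> on the target are related to
  \<open>X\<close> and \<open>Y\<close> only through their classes at \<open>\<phi> a\<close>, and
  this is all that \<open>bracket_congruence\<close> asks for.\<close>

lemma gr_map_bracket:
  assumes w: "1 \<le> w" "1 \<le> w'" "w + w' \<le> r" and A: "A \<in> gr H w a" and B: "B \<in> gr H w' a"
  shows "gr_map M' H' \<phi> a (w + w') (gr_bracket M H a w w' A B) =
    gr_bracket M' H' (\<phi> a) w w' (gr_map M' H' \<phi> a w A) (gr_map M' H' \<phi> a w' B)"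
proof -
  have le: "w \<le> r" "w' \<le> r" using w by auto
  note b = carnot_map_topspace[OF map a]
  obtain U X Y where U: "openin (mtop M) U" "a \<in> U"
    and XY: "bundle_section M (H w) U X" "bundle_section M (H w') U Y"
    and AB: "A = gr_class H w a (X a)" "B = gr_class H w' a (Y a)"
    by (rule gr_bracket_sections[OF carnot a w A B])
  have in_H: "X a \<in> H w a" "Y a \<in> H w' a" using XY U(2) by (auto simp: bundle_section_def)
  obtain V X' Y' where V: "openin (mtop M') V" "\<phi> a \<in> V"
    and XY': "bundle_section M' (H' w) V X'" "bundle_section M' (H' w') V Y'"
    and AB': "gr_map M' H' \<phi> a w A = gr_class H' w (\<phi> a) (X' (\<phi> a))"
      "gr_map M' H' \<phi> a w' B = gr_class H' w' (\<phi> a) (Y' (\<phi> a))"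
    by (rule gr_bracket_sections[OF carnot' b w gr_map_closed[OF le(1) A] gr_map_closed[OF le(2) B]])
  have "differential M' \<phi> a (X a) - X' (\<phi> a) \<in> H' (w - 1) (\<phi> a)"
    using AB'(1) gr_map_class[OF le(1) in_H(1)] carnot_map_differential[OF carnot carnot' map a le(1) in_H(1)]
    by (intro gr_class_eqD[of H' w "\<phi> a", OF carnot_graded[OF carnot' b le(1)]]) (simp_all add: AB)
  moreover have "differential M' \<phi> a (Y a) - Y' (\<phi> a) \<in> H' (w' - 1) (\<phi> a)"
    using AB'(2) gr_map_class[OF le(2) in_H(2)] carnot_map_differential[OF carnot carnot' map a le(2) in_H(2)]
    by (intro gr_class_eqD[of H' w' "\<phi> a", OF carnot_graded[OF carnot' b le(2)]]) (simp_all add: AB)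
  ultimately have "differential M' \<phi> a (vf_bracket M X Y a) - vf_bracket M' X' Y' (\<phi> a)
      \<in> H' (w + w' - 1) (\<phi> a)"
    by (rule bracket_congruence[OF carnot carnot' map a w U XY V XY'])
  then have "gr_class H' (w + w') (\<phi> a) (differential M' \<phi> a (vf_bracket M X Y a)) =
      gr_class H' (w + w') (\<phi> a) (vf_bracket M' X' Y' (\<phi> a))"
    by (rule gr_class_eqI[of H' "w + w'" "\<phi> a", OF carnot_graded[OF carnot' b w(3)]])
  moreover have "gr_map M' H' \<phi> a (w + w') (gr_bracket M H a w w' A B) =
      gr_class H' (w + w') (\<phi> a) (differential M' \<phi> a (vf_bracket M X Y a))"
    unfolding AB gr_bracket_class[OF carnot w U XY]
    by (rule gr_map_class[OF w(3) carnot_bracket[OF carnot w(2,3) U XY]])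
  ultimately show ?thesis
    unfolding AB' gr_bracket_class[OF carnot' w V XY'] by simp
qed

lemma gr_map_hom:
  "w \<le> r \<Longrightarrow> gr_map M' H' \<phi> a w \<in>
    hom \<lparr>carrier = gr H w a, monoid.mult = gr_add H w a, one = gr_class H w a 0\<rparr>
      \<lparr>carrier = gr H' w (\<phi> a), monoid.mult = gr_add H' w (\<phi> a), one = gr_class H' w (\<phi> a) 0\<rparr>"
  by (simp add: hom_def gr_map_closed gr_map_add)

text \<open>In degree \<open>k\<close> the bracket is a finite sum in one graded piece, on which
  \<open>gr_map\<close> is a homomorphism; this reduces the claim to \<open>gr_map_bracket\<close>
  for degrees \<open>w\<close> and \<open>k - w\<close>.\<close>

lemma carnot_differential_bracket:
  assumes x: "x \<in> carrier (osc_algebra r M H a)" and y: "y \<in> carrier (osc_algebra r M H a)"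
  shows "carnot_differential r M' H' \<phi> a (lbr (osc_algebra r M H a) x y) =
    lbr (osc_algebra r M' H' (\<phi> a)) (carnot_differential r M' H' \<phi> a x) (carnot_differential r M' H' \<phi> a y)"
proof -
  note b = carnot_map_topspace[OF map a]
  have "gr_map M' H' \<phi> a k (gr_sum H k a (\<lambda>w. gr_bracket M H a w (k - w) (x w) (y (k - w))) {1..<k}) =
      gr_sum H' k (\<phi> a) (\<lambda>w. gr_bracket M' H' (\<phi> a) w (k - w)
        (carnot_differential r M' H' \<phi> a x w) (carnot_differential r M' H' \<phi> a y (k - w))) {1..<k}"
    if k: "k \<in> {1..r}" for k
  proof -
    have le: "k \<le> r" using k by simp
    note closed = osc_algebra_gr_bracket_closed[OF carnot a x y le]
    have eq: "gr_map M' H' \<phi> a k (gr_bracket M H a w (k - w) (x w) (y (k - w))) =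
        gr_bracket M' H' (\<phi> a) w (k - w)
          (carnot_differential r M' H' \<phi> a x w) (carnot_differential r M' H' \<phi> a y (k - w))"
      if w: "w \<in> {1..<k}" for w
      using gr_map_bracket[of w "k - w" "x w" "y (k - w)"] w le x y
      by (auto simp: carnot_differential_eq_gr_map osc_algebra_def PiE_iff)
    have "gr_map M' H' \<phi> a k (gr_sum H k a (\<lambda>w. gr_bracket M H a w (k - w) (x w) (y (k - w))) {1..<k}) =
        gr_sum H' k (\<phi> a) (\<lambda>w. gr_map M' H' \<phi> a k (gr_bracket M H a w (k - w) (x w) (y (k - w)))) {1..<k}"
      unfolding gr_sum_def
      by (rule finprod_hom[OF carnot_gr_comm_monoid[OF carnot a le]
            carnot_gr_comm_monoid[OF carnot' b le] gr_map_hom[OF le]])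
        (simp_all add: gr_map_zero[OF le] closed del: atLeastLessThan_iff)
    also have "\<dots> = gr_sum H' k (\<phi> a) (\<lambda>w. gr_bracket M' H' (\<phi> a) w (k - w)
        (carnot_differential r M' H' \<phi> a x w) (carnot_differential r M' H' \<phi> a y (k - w))) {1..<k}"
      unfolding gr_sum_def
    \<comment> \<open>The congruence rule requires the new terms to lie in the carrier; by
      \<open>eq\<close> they are images of brackets known to lie in the source piece.\<close>
    proof (rule comm_monoid.finprod_cong'[OF carnot_gr_comm_monoid[OF carnot' b le] refl])
      show "(\<lambda>w. gr_bracket M' H' (\<phi> a) w (k - w)
            (carnot_differential r M' H' \<phi> a x w) (carnot_differential r M' H' \<phi> a y (k - w)))
          \<in> {1..<k} \<rightarrow> carrier \<lparr>carrier = gr H' k (\<phi> a), monoid.mult = gr_add H' k (\<phi> a),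
            one = gr_class H' k (\<phi> a) 0\<rparr>"
      proof
        fix w assume w: "w \<in> {1..<k}"
        show "gr_bracket M' H' (\<phi> a) w (k - w)
            (carnot_differential r M' H' \<phi> a x w) (carnot_differential r M' H' \<phi> a y (k - w))
          \<in> carrier \<lparr>carrier = gr H' k (\<phi> a), monoid.mult = gr_add H' k (\<phi> a),
            one = gr_class H' k (\<phi> a) 0\<rparr>"
          using gr_map_closed[OF le closed[OF w]] unfolding eq[OF w] by simp
      qed
    qed (rule eq)
    finally show ?thesis .
  qed
  \<comment> \<open>For \<open>k\<close> outside \<open>{1..r}\<close> both sides are
    \<open>undefined\<close>.\<close>
  then have "carnot_differential r M' H' \<phi> a (lbr (osc_algebra r M H a) x y) k =
    lbr (osc_algebra r M' H' (\<phi> a)) (carnot_differential r M' H' \<phi> a x) (carnot_differential r M' H' \<phi> a y) k"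
    for k
    unfolding carnot_differential_eq_gr_map[of r M' H' \<phi> a "lbr (osc_algebra r M H a) x y"]
    by (auto simp: osc_algebra_def)
  then show ?thesis by (rule ext)
qed

lemma carnot_differential_lie_alg_hom:
  "carnot_differential r M' H' \<phi> a \<in> lie_alg_hom (osc_algebra r M H a) (osc_algebra r M' H' (\<phi> a))"
  unfolding lie_alg_hom_def
proof (intro CollectI conjI ballI allI funcsetI)
  fix x assume x: "x \<in> carrier (osc_algebra r M H a)"
  then show "carnot_differential r M' H' \<phi> a x \<in> carrier (osc_algebra r M' H' (\<phi> a))"
    by (auto simp: carnot_differential_eq_gr_map osc_algebra_def gr_map_closed PiE_iff)
  show "carnot_differential r M' H' \<phi> a (lscale (osc_algebra r M H a) c x) =
      lscale (osc_algebra r M' H' (\<phi> a)) c (carnot_differential r M' H' \<phi> a x)" for c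
    using x by (auto simp: carnot_differential_eq_gr_map osc_algebra_def gr_map_scale PiE_iff
        intro!: restrict_ext)
  fix y assume y: "y \<in> carrier (osc_algebra r M H a)"
  show "carnot_differential r M' H' \<phi> a (ladd (osc_algebra r M H a) x y) =
      ladd (osc_algebra r M' H' (\<phi> a)) (carnot_differential r M' H' \<phi> a x) (carnot_differential r M' H' \<phi> a y)"
    using x y by (auto simp: carnot_differential_eq_gr_map osc_algebra_def gr_map_add PiE_iff
        intro!: restrict_ext)
qed (rule carnot_differential_bracket)

text \<open>Preservation of zero is not listed in \<open>lie_alg_hom\<close>, but the Dynkin sums
  and the empty nested bracket call for it.\<close>

lemma carnot_differential_zero:
  "carnot_differential r M' H' \<phi> a (lzero (osc_algebra r M H a)) = lzero (osc_algebra r M' H' (\<phi> a))"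
  by (auto simp: carnot_differential_eq_gr_map osc_algebra_def gr_map_zero intro!: restrict_ext)

end

theorem proposition5p4:
  fixes M :: "('a, 'e::real_inner) mfd" and M' :: "('b, 'f::real_inner) mfd"
    and H :: "nat \<Rightarrow> 'a \<Rightarrow> 'a tvec set" and H' :: "nat \<Rightarrow> 'b \<Rightarrow> 'b tvec set"
    and \<phi> :: "'a \<Rightarrow> 'b" and r :: nat and a :: 'a
  assumes "carnot_manifold r M H"
    and "carnot_manifold r M' H'"
    and "carnot_map r M H M' H' \<phi>"
    and "a \<in> topspace (mtop M)"
  shows "carnot_differential r M' H' \<phi> a
           \<in> lie_alg_hom (osc_algebra r M H a) (osc_algebra r M' H' (\<phi> a))
       \<and> carnot_differential r M' H' \<phi> a
           \<in> hom (tangent_group r M H a) (tangent_group r M' H' (\<phi> a))"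
proof
  show lie: "carnot_differential r M' H' \<phi> a
      \<in> lie_alg_hom (osc_algebra r M H a) (osc_algebra r M' H' (\<phi> a))"
    by (rule carnot_differential_lie_alg_hom[OF assms])
  show "carnot_differential r M' H' \<phi> a
      \<in> hom (tangent_group r M H a) (tangent_group r M' H' (\<phi> a))"
    unfolding tangent_group_def
  \<comment> \<open>Both groups truncate the Dynkin series at the same step \<open>r\<close>, so the
    two sums run over the same index set.\<close>
  proof (rule dynkin_group_hom[OF _ _ _ _ lie])
    show "carnot_differential r M' H' \<phi> a (lzero (osc_algebra r M H a)) =
        lzero (osc_algebra r M' H' (\<phi> a))"
      by (rule carnot_differential_zero[OF assms])
  qed (simp_all add: osc_algebra_comm_monoid[OF assms(1,4)]
        osc_algebra_comm_monoid[OF assms(2) carnot_map_topspace[OF assms(3,4)]]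
        osc_algebra_scale_closed[OF assms(1,4)] osc_algebra_bracket_closed[OF assms(1,4)])
qed

end
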